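(* Let $a>0$. For each $n\ge 1$ let $(p^{(n)}(x,y))_{x,y\in V^{(n)}}$ be the transition matrix of an irreducible Markov chain $X^{(n)}$ on a finite state space $V^{(n)}$ with unique stationary distribution $\pi^{(n)}$, and let $c^{(n)}>0$ satisfy $c^{(n)}=e^{-a\cdot\sharp V^{(n)}+o(\sharp V^{(n)})}$ as $n\to\infty$. Let $\nu^{(n)}$ be the empirical distribution of the eigenvalues of $p^{(n)}$, and let $\mu^{(n)}$ and $\bar\mu^{(n)}$ be the associated loop measure and normalized loop measure (defined in the context). Assume: (i) $\nu^{(n)}$ converges weakly to a probability measure $\nu$ as $n\to\infty$; (ii) there exist constants $c_1,c_2>0$ independent of $n$ such that for all $n$ $$\min_{x\in V^{(n)}}\pi^{(n)}(x)\cdot\sharp V^{(n)}\ge c_1,\qquad \min_{\substack{x,y\in V^{(n)}\\ p^{(n)}(x,y)+p^{(n)}(y,x)>0}}p^{(n)}(x,y)\ge c_2 .$$ Let $(q_n)_n$ be a sequence such that $\lim_{n\to\infty}q_n=\infty$ and $\log q_n=o(\sharp V^{(n)})$ as $n\to\infty$. Then: a) $\int |\log(1-x)|\,\nu(\mathrm{d}x)\le 3+8\sqrt{2}\,c_1^{-1}c_2^{-4}$; b) $\lim_{n\to\infty}\|\mu^{(n)}\|/\sharp V^{(n)}=a+\int -\log(1-x)\,\nu(\mathrm{d}x)$, where $\|\mu^{(n)}\|$ is the total mass of $\mu^{(n)}$; c) $\lim_{n\to\infty}\bar\mu^{(n)}(|\ell|\ge q_n)=\dfrac{a}{a+\int-\log(1-x)\,\nu(\mathrm{d}x)}$;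 d) for every integer $j\ge 1$, $\lim_{n\to\infty}\bar\mu^{(n)}\big(|\ell|=j\,\big|\,|\ell|\le q_n\big)=\dfrac{j^{-1}\int x^j\,\nu(\mathrm{d}x)}{\int-\log(1-x)\,\nu(\mathrm{d}x)}$; e) as $n\to\infty$, the law of $\log|\ell|/\sharp V^{(n)}$ under the conditional probability $\bar\mu^{(n)}(\,\cdot\,\big|\,|\ell|\ge q_n)$ converges weakly to the uniform distribution on $(0,a)$, i.e. to $1_{0<x<a}\cdot\frac1a\,\mathrm{d}x$.
   Context: $\sharp V$ denotes the cardinality of a finite set $V$. Loops and loop measures. A based loop on $V^{(n)}$ is an element $\dot\ell=(x_1,\ldots,x_k)\in (V^{(n)})^k$, $k\ge1$; its length is $|\dot\ell|=k$. Two based loops are equivalent if they coincide up to a circular permutation, and a loop $\ell$ is an equivalence class of based loops; its length $|\ell|$ is the common length of its representatives. The based loop measure $\dot\mu^{(n)}$ gives the based loop $\dot\ell=(x_1,\ldots,x_k)$ the mass $$\dot\mu^{(n)}(\dot\ell)=\frac1k(1+c^{(n)})^{-k}\,p^{(n)}(x_1,x_2)p^{(n)}(x_2,x_3)\cdots p^{(n)}(x_k,x_1)$$ (for $k=1$ the product is $p^{(n)}(x_1,x_1)$). The loop measure $\mu^{(n)}$ is the push-forward of $\dot\mu^{(n)}$ to the space of loops, $\|\mu^{(n)}\|$ is its (finite) total mass, and $\bar\mu^{(n)}=\mu^{(n)}/\|\mu^{(n)}\|$ is the normalized probability measure. Empirical eigenvalue distribution. $\nu^{(n)}=\frac{1}{\sharp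 V^{(n)}}\sum_{i=1}^{\sharp V^{(n)}}\delta_{\lambda_{n,i}}$, where $\lambda_{n,1},\ldots,\lambda_{n,\sharp V^{(n)}}\in\mathbb{C}$ are the eigenvalues of the matrix $p^{(n)}$ with algebraic multiplicity. It is a probability measure on the closed unit disk of $\mathbb{C}$, and so is its weak limit $\nu$; integrals against $\nu$ are over this disk, and $\log(1-x)$ is the principal branch of the logarithm. *)

theory Defs
  imports
    "HOL-Probability.Probability"
    "HOL-Library.Landau_Symbols"
    "Jordan_Normal_Form.Char_Poly"
begin

definition transition_matrix :: "'a set \<Rightarrow> ('a \<Rightarrow> 'a \<Rightarrow> real) \<Rightarrow> bool" where
  "transition_matrix V p \<longleftrightarrow>
     (\<forall>x\<in>V. \<forall>y\<in>V. 0 \<le> p x y) \<and> (\<forall>x\<in>V. (\<Sum>y\<in>V. p x y) = 1)"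

primrec step_prob :: "'a set \<Rightarrow> ('a \<Rightarrow> 'a \<Rightarrow> real) \<Rightarrow> nat \<Rightarrow> 'a \<Rightarrow> 'a \<Rightarrow> real" where
  "step_prob V p 0 x y = (if x = y then 1 else 0)"
| "step_prob V p (Suc k) x y = (\<Sum>z\<in>V. p x z * step_prob V p k z y)"

definition irreducible_chain :: "'a set \<Rightarrow> ('a \<Rightarrow> 'a \<Rightarrow> real) \<Rightarrow> bool" where
  "irreducible_chain V p \<longleftrightarrow> (\<forall>x\<in>V. \<forall>y\<in>V. \<exists>k. 0 < step_prob V p k x y)"

definition stationary_distribution ::
    "'a set \<Rightarrow> ('a \<Rightarrow> 'a \<Rightarrow> real) \<Rightarrow> ('a \<Rightarrow> real) \<Rightarrow> bool" where
  "stationary_distribution V p \<pi> \<longleftrightarrow>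
     (\<forall>x\<in>V. 0 \<le> \<pi> x) \<and> (\<Sum>x\<in>V. \<pi> x) = 1 \<and> (\<forall>y\<in>V. (\<Sum>x\<in>V. \<pi> x * p x y) = \<pi> y)"

text \<open>
  Matrices of the library are indexed by natural numbers, so the states are enumerated.
  The characteristic polynomial does not depend on the chosen enumeration.
\<close>

definition state_enum :: "'a set \<Rightarrow> nat \<Rightarrow> 'a" where
  "state_enum V = (SOME e. bij_betw e {..<card V} V)"

definition matrix_of :: "'a set \<Rightarrow> ('a \<Rightarrow> 'a \<Rightarrow> real) \<Rightarrow> complex mat" where
  "matrix_of V p =
     Matrix.mat (card V) (card V) (\<lambda>(i, j). complex_of_real (p (state_enum V i) (state_enum V j)))"

text \<open>
  The multiset of roots of the characteristic polynomial lists the eigenvalues with algebraic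
  multiplicity. It has \<^term>\<open>card V\<close> elements, and \<^const>\<open>pmf_of_multiset\<close> gives
  each of them (counted with multiplicity) the mass \<^term>\<open>1 / card V\<close>.
\<close>

definition eigenvalue_distribution :: "'a set \<Rightarrow> ('a \<Rightarrow> 'a \<Rightarrow> real) \<Rightarrow> complex measure" where
  "eigenvalue_distribution V p =
     distr (measure_pmf (pmf_of_multiset (proots (char_poly (matrix_of V p))))) borel (\<lambda>x. x)"

text \<open>
  The library's \<^const>\<open>weak_conv_m\<close> is defined through distribution functions and is
  confined to measures on the real line; the following is its counterpart on the complex plane.
\<close>

definition weakly_converges :: "(nat \<Rightarrow> complex measure) \<Rightarrow> complex measure \<Rightarrow> bool" where
  "weakly_converges M_seq M \<longleftrightarrow>
     (\<forall>f :: complex \<Rightarrow> real. continuous_on UNIV f \<and> bounded (range f) \<longrightarrow>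
        (\<lambda>n. \<integral>x. f x \<partial>(M_seq n)) \<longlonglongrightarrow> (\<integral>x. f x \<partial>M))"

definition based_loops :: "'a set \<Rightarrow> 'a list set" where
  "based_loops V = {xs. xs \<noteq> [] \<and> set xs \<subseteq> V}"

definition based_loop_weight :: "('a \<Rightarrow> 'a \<Rightarrow> real) \<Rightarrow> real \<Rightarrow> 'a list \<Rightarrow> real" where
  "based_loop_weight p c xs =
     (let k = length xs in
      1 / real k * inverse ((1 + c) ^ k) * (\<Prod>i<k. p (xs ! i) (xs ! (Suc i mod k))))"

definition based_loop_measure ::
    "'a set \<Rightarrow> ('a \<Rightarrow> 'a \<Rightarrow> real) \<Rightarrow> real \<Rightarrow> 'a list measure" where
  "based_loop_measure V p c =
     point_measure (based_loops V) (\<lambda>xs. ennreal (based_loop_weight p c xs))"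

definition loop_rel :: "'a set \<Rightarrow> ('a list \<times> 'a list) set" where
  "loop_rel V = {(xs, ys). xs \<in> based_loops V \<and> ys \<in> based_loops V \<and> (\<exists>m. ys = rotate m xs)}"

definition loops :: "'a set \<Rightarrow> 'a list set set" where
  "loops V = based_loops V // loop_rel V"

definition loop_length :: "'a list set \<Rightarrow> nat" where
  "loop_length L = (THE k. \<forall>xs\<in>L. length xs = k)"

definition loop_measure ::
    "'a set \<Rightarrow> ('a \<Rightarrow> 'a \<Rightarrow> real) \<Rightarrow> real \<Rightarrow> 'a list set measure" where
  "loop_measure V p c =
     distr (based_loop_measure V p c) (count_space (loops V)) (\<lambda>xs. loop_rel V `` {xs})"

definition total_mass :: "'b measure \<Rightarrow> real" where
  "total_mass M = measure M (space M)"

definition normalized_loop_measure ::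
    "'a set \<Rightarrow> ('a \<Rightarrow> 'a \<Rightarrow> real) \<Rightarrow> real \<Rightarrow> 'a list set measure" where
  "normalized_loop_measure V p c =
     scale_measure (ennreal (1 / total_mass (loop_measure V p c))) (loop_measure V p c)"

text \<open>
  \<^term>\<open>Ln 0\<close> is an unspecified complex number in the library, so the singularity of
  \<open>\<bar>log (1 - x)\<bar>\<close> at \<open>x = 1\<close> has to be restored by hand. If the integral of this function
  is finite, there is no atom at \<open>1\<close>, and the value of \<^const>\<open>Ln\<close> at \<open>0\<close> is immaterial.
\<close>

definition abs_log_one_minus :: "complex \<Rightarrow> ennreal" where
  "abs_log_one_minus x = (if x = 1 then \<infinity> else ennreal (cmod (Ln (1 - x))))"

definition neg_log_integral :: "complex measure \<Rightarrow> complex" where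
  "neg_log_integral \<nu> = (LINT x:cball 0 1|\<nu>. - Ln (1 - x))"

end

theory Submission
  imports Defs "Jordan_Normal_Form.Schur_Decomposition"
    "HOL-Complex_Analysis.Cauchy_Integral_Theorem" "HOL-Real_Asymp.Real_Asymp"
begin

text \<open>
  Write \<open>N\<close> for the number of states and \<open>Tr\<close> for the trace. A rotation class of closed paths of length
  \<open>k\<close> is counted in the loop measure in such a way that all loops of length \<open>k\<close> together have the mass
  \<open>(1 + c)\<^sup>-\<^sup>k * Tr (p\<^sup>k) / k\<close> (\<open>emeasure_loop_measure\<close>). So every claim is about the numbers \<open>Tr (p\<^sup>k)\<close>,
  which are power sums of the eigenvalues. Summed over \<open>k\<close> they give the total mass
  \<open>- ln det (1 - p / (1 + c)) = N * ln (1 + c) - (\<Sum>\<lambda>. ln \<bar>1 + c - \<lambda>\<bar>)\<close>. The eigenvalue \<open>1\<close> contributes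
  \<open>- ln c\<close>, which is about \<open>a * N\<close>. The others should contribute \<open>N\<close> times the integral \<open>I\<close> of
  \<open>- ln \<bar>1 - x\<bar>\<close> with respect to \<open>\<nu>\<close>. As this function is unbounded at \<open>1\<close>, weak convergence only
  yields this if few eigenvalues are close to \<open>1\<close>, uniformly in \<open>n\<close>.

  That is the heart of the proof, and it rests on the bound
  \<open>(\<Sum>\<lambda>. Re (1 / (s + 1 - \<lambda>))) \<le> C * N / sqrt s\<close> for the eigenvalues other than \<open>1\<close>, with
  \<open>C = sqrt 2 / (c\<^sub>1 * c\<^sub>2)\<close> (\<open>resolvent_trace_bound\<close>). The left side is the trace of a resolvent, hence a
  sum over the states \<open>x\<close> of values \<open>h x\<close>, where \<open>h\<close> solves a Poisson equation with killing rate \<open>s\<close>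
  and source at \<open>x\<close>. The energy identity of this equation only involves the Dirichlet form, which a
  nonreversible chain shares with its additive symmetrization, and a connected graph whose edges have
  weights of order at least \<open>1 / N\<close> satisfies a one-dimensional Sobolev inequality; together they bound \<open>h x\<close> (\<open>killed_poisson_bound\<close>). Integration over \<open>s\<close> shows that the
  logarithm may be cut off at the level \<open>\<epsilon>\<close> with an error of at most \<open>2 * C * sqrt \<epsilon>\<close> per state
  (\<open>log_truncation_bound\<close>). The case \<open>\<epsilon> = 1\<close> gives the integrability of the logarithm with an
  explicit bound, and small \<open>\<epsilon>\<close> give the limit \<open>a + I\<close> of the total mass per state. More generally, a
  killing rate \<open>c\<close> with \<open>- ln c / N\<close> tending to \<open>b\<close> yields \<open>b + I\<close> (\<open>total_mass_tendsto\<close>).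

  Since the traces are nonnegative, cutting the lengths off at \<open>u\<close> amounts to killing at a rate of about
  \<open>1 / u\<close>. Hence the loops of length at most \<open>u\<close> have the mass \<open>b + I\<close> per state if \<open>ln u / N\<close> tends to
  \<open>b < a\<close> (\<open>truncated_mass_tendsto\<close>). For the subexponential cut-off \<open>q\<close> this is \<open>I\<close>, so that short
  loops carry \<open>I\<close> and long loops carry \<open>a\<close> out of the total \<open>a + I\<close>. For \<open>u = exp (x * N)\<close> it is
  \<open>x + I\<close>: the mass of the long loops is spread uniformly over the logarithm of the length.
\<close>

section \<open>Traces of powers and eigenvalues\<close>

definition eigenvalues :: "'a set \<Rightarrow> ('a \<Rightarrow> 'a \<Rightarrow> real) \<Rightarrow> complex multiset" where
  "eigenvalues V p = proots (char_poly (matrix_of V p))"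

text \<open>
  The trace of the \<open>k\<close>-th power of the transition matrix.
\<close>

definition return_sum :: "'a set \<Rightarrow> ('a \<Rightarrow> 'a \<Rightarrow> real) \<Rightarrow> nat \<Rightarrow> real" where
  "return_sum V p k = (\<Sum>x\<in>V. step_prob V p k x x)"

definition mat_trace :: "complex mat \<Rightarrow> complex" where
  "mat_trace A = (\<Sum>i<dim_row A. A $$ (i, i))"

lemma state_enum_bij: "finite V \<Longrightarrow> bij_betw (state_enum V) {..<card V} V"
  unfolding state_enum_def
  using ex_bij_betw_nat_finite[of V] by (metis atLeast0LessThan someI_ex)

lemma matrix_of_carrier [simp]: "matrix_of V p \<in> carrier_mat (card V) (card V)"
  by (simp add: matrix_of_def)

lemma step_prob_Suc_right:
  assumes "finite V" "x \<in> V" "y \<in> V"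
  shows "step_prob V p (Suc k) x y = (\<Sum>z\<in>V. step_prob V p k x z * p z y)"
  using assms(2)
proof (induction k arbitrary: x)
  case 0
  have "(\<Sum>z\<in>V. p x z * (if z = y then 1 else 0)) = (\<Sum>z\<in>V. if z = y then p x z else 0)"
    by (rule sum.cong) auto
  moreover have "(\<Sum>z\<in>V. (if x = z then 1 else 0) * p z y) = (\<Sum>z\<in>V. if x = z then p z y else 0)"
    by (rule sum.cong) auto
  ultimately show ?case using assms 0 by (simp add: sum.delta)
next
  case (Suc k)
  have "step_prob V p (Suc (Suc k)) x y = (\<Sum>z\<in>V. p x z * (\<Sum>w\<in>V. step_prob V p k z w * p w y))"
    using Suc.IH by (simp del: step_prob.simps add: step_prob.simps(2)[of _ _ "Suc k"] cong: sum.cong)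
  also have "\<dots> = (\<Sum>w\<in>V. (\<Sum>z\<in>V. p x z * step_prob V p k z w) * p w y)"
    by (simp add: sum_distrib_left sum_distrib_right mult.assoc) (rule sum.swap)
  finally show ?case by simp
qed

lemma matrix_of_power:
  assumes "finite V" "i < card V" "j < card V"
  shows "(matrix_of V p ^\<^sub>m k) $$ (i, j) =
           complex_of_real (step_prob V p k (state_enum V i) (state_enum V j))"
  using assms(2,3)
proof (induction k arbitrary: i j)
  case 0
  have "state_enum V i = state_enum V j \<longleftrightarrow> i = j"
    using 0 state_enum_bij[OF assms(1)] by (auto simp: bij_betw_def inj_on_def)
  then show ?case using 0 by (simp add: matrix_of_def)
next
  case (Suc k)
  note bij = state_enum_bij[OF assms(1)]
  have V: "state_enum V i \<in> V" if "i < card V" for i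
    using bij that by (auto simp: bij_betw_def)
  have [simp]: "dim_row (matrix_of V p ^\<^sub>m k) = card V" "dim_col (matrix_of V p ^\<^sub>m k) = card V"
    "dim_col (matrix_of V p) = card V" "dim_row (matrix_of V p) = card V"
    using pow_carrier_mat[OF matrix_of_carrier[of V p]] by (auto simp: matrix_of_def)
  have "(matrix_of V p ^\<^sub>m Suc k) $$ (i, j) =
          (\<Sum>l<card V. (matrix_of V p ^\<^sub>m k) $$ (i, l) * matrix_of V p $$ (l, j))"
    using Suc.prems by (simp add: scalar_prod_def atLeast0LessThan)
  also have "\<dots> = (\<Sum>l<card V. complex_of_real
      (step_prob V p k (state_enum V i) (state_enum V l) * p (state_enum V l) (state_enum V j)))"
    using Suc.prems Suc.IH by (intro sum.cong) (auto simp: matrix_of_def)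
  also have "\<dots> = complex_of_real (\<Sum>z\<in>V. step_prob V p k (state_enum V i) z * p z (state_enum V j))"
    by (subst sum.reindex_bij_betw[OF bij, symmetric]) simp
  also have "\<dots> = complex_of_real (step_prob V p (Suc k) (state_enum V i) (state_enum V j))"
    using step_prob_Suc_right[OF assms(1) V[OF Suc.prems(1)] V[OF Suc.prems(2)]] by simp
  finally show ?case .
qed

lemma mat_trace_mult_commute:
  assumes "A \<in> carrier_mat n n" "B \<in> carrier_mat n n"
  shows "mat_trace (A * B) = mat_trace (B * A)"
proof -
  have "mat_trace (A * B) = (\<Sum>i<n. \<Sum>l<n. A $$ (i, l) * B $$ (l, i))"
    using assms by (simp add: mat_trace_def scalar_prod_def atLeast0LessThan)
  also have "\<dots> = (\<Sum>l<n. \<Sum>i<n. B $$ (l, i) * A $$ (i, l))"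
    by (subst sum.swap) (simp add: mult.commute)
  also have "\<dots> = mat_trace (B * A)"
    using assms by (simp add: mat_trace_def scalar_prod_def atLeast0LessThan)
  finally show ?thesis .
qed

lemma upper_triangular_power:
  fixes B :: "complex mat"
  assumes B: "B \<in> carrier_mat n n" and ut: "upper_triangular B"
  shows "upper_triangular (B ^\<^sub>m k) \<and> (\<forall>i<n. (B ^\<^sub>m k) $$ (i, i) = (B $$ (i, i)) ^ k)"
proof (induction k)
  case 0
  show ?case using B by (auto simp: upper_triangular_def)
next
  case (Suc k)
  let ?C = "B ^\<^sub>m k"
  have C: "?C \<in> carrier_mat n n" using B by simp
  have ent: "(?C * B) $$ (i, j) = (if i = j then ?C $$ (i, i) * B $$ (i, i) else 0)"
    if "i < n" "j < n" "j \<le> i" for i j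
  proof -
    have "(?C * B) $$ (i, j) = (\<Sum>l<n. ?C $$ (i, l) * B $$ (l, j))"
      using B C that by (simp add: scalar_prod_def atLeast0LessThan)
    also have "\<dots> = (\<Sum>l<n. if l = i then (if i = j then ?C $$ (i, i) * B $$ (i, i) else 0) else 0)"
    proof (rule sum.cong)
      fix l assume l: "l \<in> {..<n}"
      have "?C $$ (i, l) = 0" if "l < i"
        using Suc.IH C that \<open>i < n\<close> by (auto simp: upper_triangular_def)
      moreover have "B $$ (l, j) = 0" if "j < l"
        using ut B that l by (auto simp: upper_triangular_def)
      ultimately show "?C $$ (i, l) * B $$ (l, j) =
          (if l = i then (if i = j then ?C $$ (i, i) * B $$ (i, i) else 0) else 0)"
        using that by (cases l i rule: linorder_cases) auto
    qed simp
    finally show ?thesis using that by simp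
  qed
  show ?case using ent Suc.IH B C by (auto simp: upper_triangular_def)
qed

lemma char_poly_nonzero: "A \<in> carrier_mat n n \<Longrightarrow> char_poly (A :: complex mat) \<noteq> 0"
  using degree_monic_char_poly[of A n] by auto

text \<open>
  Over the complex numbers every matrix is similar to an upper triangular one. The trace does not see
  the change of basis, and the power of a triangular matrix carries the powers of its diagonal entries,
  that is of the eigenvalues, on the diagonal.
\<close>

lemma mat_trace_power_eq_power_sum:
  assumes A: "A \<in> carrier_mat n n"
  shows "mat_trace (A ^\<^sub>m k) = (\<Sum>z\<in>#proots (char_poly A). z ^ k)"
proof -
  obtain es where es: "char_poly A = (\<Prod>a\<leftarrow>es. [:- a, 1:])"
    using char_poly_factorized[OF A] by auto
  obtain B where B: "B \<in> carrier_mat n n" "upper_triangular B" "similar_mat A B"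
    using schur_decomposition_exists[OF A es] by auto
  have "char_poly A = (\<Prod>a\<leftarrow>diag_mat B. [:- a, 1:])"
    using char_poly_similar[OF B(3)] char_poly_upper_triangular[OF B(1,2)] by simp
  moreover have "proots (\<Prod>a\<leftarrow>xs. [:- a, 1:]) = mset xs" for xs :: "complex list"
  proof (induction xs)
    case (Cons a xs)
    have "(\<Prod>a\<leftarrow>xs. [:- a, 1:]) \<noteq> 0"
      unfolding prod_list_zero_iff by auto
    then have "proots ([:- a, 1:] * (\<Prod>a\<leftarrow>xs. [:- a, 1:])) = {#a#} + mset xs"
      using Cons by (subst proots_mult) auto
    then show ?case by simp
  qed simp
  ultimately have roots: "proots (char_poly A) = mset (diag_mat B)"
    by simp
  obtain P Q where wit: "similar_mat_wit A B P Q"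
    using B(3) unfolding similar_mat_def by auto
  note PQ = similar_mat_witD2[OF A wit]
  have Bk: "B ^\<^sub>m k \<in> carrier_mat n n" using B by simp
  have "mat_trace (A ^\<^sub>m k) = mat_trace (P * B ^\<^sub>m k * Q)"
    using similar_mat_wit_pow_id[OF wit] by simp
  also have "\<dots> = mat_trace (Q * (P * B ^\<^sub>m k))"
    using PQ Bk by (intro mat_trace_mult_commute[of _ n]) auto
  also have "Q * (P * B ^\<^sub>m k) = (Q * P) * B ^\<^sub>m k"
    using PQ Bk by (intro assoc_mult_mat[symmetric]) auto
  also have "\<dots> = B ^\<^sub>m k" using PQ Bk by simp
  also have "mat_trace (B ^\<^sub>m k) = (\<Sum>i<n. (B $$ (i, i)) ^ k)"
    using upper_triangular_power[OF B(1,2), of k] B(1) by (auto simp: mat_trace_def)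
  also have "\<dots> = sum_list (map (\<lambda>i. (B $$ (i, i)) ^ k) [0..<n])"
    by (simp add: interv_sum_list_conv_sum_set_nat atLeast0LessThan)
  also have "\<dots> = sum_list (map (\<lambda>z. z ^ k) (diag_mat B))"
    using B by (simp add: diag_mat_def comp_def)
  also have "\<dots> = (\<Sum>z\<in>#proots (char_poly A). z ^ k)"
    unfolding roots by (metis mset_map sum_mset_sum_list)
  finally show ?thesis .
qed

lemma return_sum_eq_power_sum:
  assumes "finite V"
  shows "complex_of_real (return_sum V p k) = (\<Sum>z\<in>#eigenvalues V p. z ^ k)"
proof -
  have [simp]: "dim_row (matrix_of V p ^\<^sub>m k) = card V"
    using pow_carrier_mat[OF matrix_of_carrier[of V p]] by (auto simp: matrix_of_def)
  have "mat_trace (matrix_of V p ^\<^sub>m k) = complex_of_real (return_sum V p k)"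
    using matrix_of_power[OF assms, of _ _ p k, unfolded matrix_of_def]
      sum.reindex_bij_betw[OF state_enum_bij[OF assms], of "\<lambda>x. step_prob V p k x x", symmetric]
    by (simp add: mat_trace_def return_sum_def matrix_of_def)
  then show ?thesis
    using mat_trace_power_eq_power_sum[OF matrix_of_carrier, of V p k]
    by (simp add: eigenvalues_def)
qed

lemma size_eigenvalues: "size (eigenvalues V p) = card V"
  using degree_monic_char_poly[OF matrix_of_carrier[of V p]]
  by (simp add: eigenvalues_def size_proots_complex)

lemma eigenvalues_iff:
  "z \<in># eigenvalues V p \<longleftrightarrow> eigenvalue (matrix_of V p) z"
  using char_poly_nonzero[OF matrix_of_carrier[of V p]]
  by (simp add: eigenvalues_def eigenvalue_root_char_poly[OF matrix_of_carrier])

section \<open>A Sobolev bound for the killed Poisson equation\<close>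

locale finite_chain =
  fixes V :: "'a set" and p :: "'a \<Rightarrow> 'a \<Rightarrow> real" and \<pi> :: "'a \<Rightarrow> real"
  assumes fin: "finite V" and ne: "V \<noteq> {}"
    and transition: "transition_matrix V p"
    and irreducible: "irreducible_chain V p"
    and stationary: "stationary_distribution V p \<pi>"
begin

lemma p_nonneg: "x \<in> V \<Longrightarrow> y \<in> V \<Longrightarrow> 0 \<le> p x y"
  and p_row_sum: "x \<in> V \<Longrightarrow> (\<Sum>y\<in>V. p x y) = 1"
  using transition by (auto simp: transition_matrix_def)

lemma pi_nonneg: "x \<in> V \<Longrightarrow> 0 \<le> \<pi> x"
  and pi_sum: "(\<Sum>x\<in>V. \<pi> x) = 1"
  and pi_stationary: "y \<in> V \<Longrightarrow> (\<Sum>x\<in>V. \<pi> x * p x y) = \<pi> y"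
  using stationary by (auto simp: stationary_distribution_def)

lemma card_pos: "0 < card V"
  using fin ne by (simp add: card_gt_0_iff)

lemma step_prob_nonneg: "x \<in> V \<Longrightarrow> y \<in> V \<Longrightarrow> 0 \<le> step_prob V p k x y"
  by (induction k arbitrary: x) (auto intro!: sum_nonneg mult_nonneg_nonneg p_nonneg)

lemma step_prob_row_sum: "x \<in> V \<Longrightarrow> (\<Sum>y\<in>V. step_prob V p k x y) = 1"
proof (induction k arbitrary: x)
  case 0
  then show ?case using fin by simp
next
  case (Suc k)
  have "(\<Sum>y\<in>V. step_prob V p (Suc k) x y) = (\<Sum>z\<in>V. p x z * (\<Sum>y\<in>V. step_prob V p k z y))"
    by (simp add: sum_distrib_left) (rule sum.swap)
  then show ?case using Suc p_row_sum by simp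
qed

lemma step_prob_le_1:
  assumes "x \<in> V" "y \<in> V"
  shows "step_prob V p k x y \<le> 1"
  using member_le_sum[of y V "step_prob V p k x"] assms step_prob_nonneg step_prob_row_sum fin
  by simp

lemma return_sum_nonneg: "0 \<le> return_sum V p k"
  unfolding return_sum_def by (intro sum_nonneg step_prob_nonneg)

lemma return_sum_le_card: "return_sum V p k \<le> card V"
  using sum_bounded_above[of V "\<lambda>x. step_prob V p k x x" 1] step_prob_le_1
  by (simp add: return_sum_def)

text \<open>
  A set that no single step leaves is never left, so a proper one contradicts irreducibility.
\<close>

lemma no_closed_subset:
  assumes "A \<subseteq> V" "A \<noteq> {}" "A \<noteq> V"
  shows "\<exists>y\<in>A. \<exists>z\<in>V - A. 0 < p y z"
proof (rule ccontr)
  assume contra: "\<not> ?thesis"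
  have zero: "p y z = 0" if "y \<in> A" "z \<in> V - A" for y z
    using contra that p_nonneg[of y z] assms(1) by force
  have "step_prob V p k x y = 0" if "x \<in> A" "y \<in> V - A" for k x y
    using that
  proof (induction k arbitrary: x)
    case (Suc k)
    have "p x z * step_prob V p k z y = 0" if "z \<in> V" for z
      using Suc zero that by (cases "z \<in> A") auto
    then show ?case by simp
  qed auto
  moreover obtain x y where "x \<in> A" "y \<in> V - A" using assms by auto
  ultimately show False
    using irreducible assms(1) unfolding irreducible_chain_def
    by (metis DiffD1 less_irrefl subsetD)
qed

text \<open>
  Every level between the two values is crossed by an edge, because the superlevel set can be left.
  The intervals spanned by the edges therefore cover the interval between the two values, and lengths
  can be compared. This is the one-dimensional Sobolev inequality behind all spectral estimates below.
\<close>

lemma difference_le_edge_sum: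
  fixes \<phi> :: "'a \<Rightarrow> real"
  assumes x: "x \<in> V" and y0: "y0 \<in> V"
  shows "\<phi> x - \<phi> y0 \<le> (\<Sum>(y, z)\<in>{(y, z)\<in>V \<times> V. 0 < p y z}. \<bar>\<phi> y - \<phi> z\<bar>)"
proof (cases "\<phi> y0 \<le> \<phi> x")
  case False
  then have "\<phi> x - \<phi> y0 \<le> 0" by simp
  also have "\<dots> \<le> (\<Sum>(y, z)\<in>{(y, z)\<in>V \<times> V. 0 < p y z}. \<bar>\<phi> y - \<phi> z\<bar>)"
    by (rule sum_nonneg) auto
  finally show ?thesis .
next
  case True
  let ?E = "{(y, z)\<in>V \<times> V. 0 < p y z}"
  have finE: "finite ?E"
    by (rule finite_subset[of _ "V \<times> V"]) (use fin in auto)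
  have cover: "{\<phi> y0<..\<phi> x} \<subseteq> (\<Union>e\<in>?E. {\<phi> (snd e)<..\<phi> (fst e)})"
  proof
    fix t assume t: "t \<in> {\<phi> y0<..\<phi> x}"
    obtain y z where "y \<in> {v \<in> V. t \<le> \<phi> v}" "z \<in> V - {v \<in> V. t \<le> \<phi> v}" "0 < p y z"
      using no_closed_subset[of "{v \<in> V. t \<le> \<phi> v}"] t x y0 by force
    then show "t \<in> (\<Union>e\<in>?E. {\<phi> (snd e)<..\<phi> (fst e)})"
      by (intro UN_I[of "(y, z)"]) auto
  qed
  have fm: "{u<..v} \<in> fmeasurable lborel" for u v :: real
    by (cases "u \<le> v") (auto intro!: fmeasurableI)
  have len: "measure lborel {u<..v} \<le> \<bar>v - u\<bar>" for u v :: real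
    by (cases "u \<le> v") auto
  have "\<phi> x - \<phi> y0 = measure lborel {\<phi> y0<..\<phi> x}"
    using True by simp
  also have "\<dots> \<le> measure lborel (\<Union>e\<in>?E. {\<phi> (snd e)<..\<phi> (fst e)})"
    using finE by (intro measure_mono_fmeasurable cover) (auto intro!: fmeasurable.finite_UN fm)
  also have "\<dots> \<le> (\<Sum>e\<in>?E. measure lborel {\<phi> (snd e)<..\<phi> (fst e)})"
    using finE by (intro measure_UNION_le) auto
  also have "\<dots> \<le> (\<Sum>e\<in>?E. \<bar>\<phi> (fst e) - \<phi> (snd e)\<bar>)"
    by (intro sum_mono len)
  finally show ?thesis by (simp add: case_prod_unfold)
qed

text \<open>
  The edge measure \<open>\<pi> y * p y z\<close> has both marginals equal to \<open>\<pi>\<close>: the first because rows sum to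
  one, the second by stationarity.
\<close>

lemma stationary_edge_sums:
  shows "(\<Sum>y\<in>V. \<Sum>z\<in>V. \<pi> y * p y z * f y) = (\<Sum>y\<in>V. \<pi> y * f y)"
    and "(\<Sum>y\<in>V. \<Sum>z\<in>V. \<pi> y * p y z * f z) = (\<Sum>y\<in>V. \<pi> y * f y)"
proof -
  have "(\<Sum>y\<in>V. \<Sum>z\<in>V. \<pi> y * p y z * f y) = (\<Sum>y\<in>V. \<pi> y * f y * (\<Sum>z\<in>V. p y z))"
    by (simp add: sum_distrib_left mult_ac)
  then show "(\<Sum>y\<in>V. \<Sum>z\<in>V. \<pi> y * p y z * f y) = (\<Sum>y\<in>V. \<pi> y * f y)"
    using p_row_sum by simp
  have "(\<Sum>y\<in>V. \<Sum>z\<in>V. \<pi> y * p y z * f z) = (\<Sum>z\<in>V. (\<Sum>y\<in>V. \<pi> y * p y z) * f z)"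
    by (subst sum.swap) (simp add: sum_distrib_right)
  then show "(\<Sum>y\<in>V. \<Sum>z\<in>V. \<pi> y * p y z * f z) = (\<Sum>y\<in>V. \<pi> y * f y)"
    using pi_stationary by simp
qed

end

text \<open>
  Squares of positive parts are Lipschitz with the local constant \<open>\<bar>u\<bar> + \<bar>v\<bar>\<close>; Young's inequality separates
  the two factors. The free parameter \<open>\<alpha>\<close> later balances the Dirichlet energy against the norm.
\<close>

lemma square_diff_young:
  fixes u v \<alpha> :: real
  assumes "\<alpha> > 0"
  shows "\<bar>(max 0 u)\<^sup>2 - (max 0 v)\<^sup>2\<bar> \<le> \<alpha> / 2 * (u - v)\<^sup>2 + 1 / \<alpha> * (u\<^sup>2 + v\<^sup>2)"
proof -
  have "\<bar>(max 0 u)\<^sup>2 - (max 0 v)\<^sup>2\<bar> = \<bar>max 0 u - max 0 v\<bar> * (max 0 u + max 0 v)"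
    by (simp add: square_diff_square_factored abs_mult mult.commute power2_eq_square)
  also have "\<dots> \<le> \<bar>u - v\<bar> * (\<bar>u\<bar> + \<bar>v\<bar>)"
    by (intro mult_mono) auto
  also have "\<dots> \<le> \<alpha> / 2 * (u - v)\<^sup>2 + 1 / (2 * \<alpha>) * (\<bar>u\<bar> + \<bar>v\<bar>)\<^sup>2"
  proof -
    have "0 \<le> (\<alpha> * \<bar>u - v\<bar> - (\<bar>u\<bar> + \<bar>v\<bar>))\<^sup>2" by simp
    then have "2 * \<alpha> * (\<bar>u - v\<bar> * (\<bar>u\<bar> + \<bar>v\<bar>)) \<le> \<alpha>\<^sup>2 * (u - v)\<^sup>2 + (\<bar>u\<bar> + \<bar>v\<bar>)\<^sup>2"
      by (simp add: power2_diff power_mult_distrib algebra_simps)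
    then show ?thesis using assms by (simp add: field_simps power2_eq_square)
  qed
  also have "(\<bar>u\<bar> + \<bar>v\<bar>)\<^sup>2 \<le> 2 * (u\<^sup>2 + v\<^sup>2)"
    using sum_squares_ge_zero[of "\<bar>u\<bar> - \<bar>v\<bar>" 0] by (simp add: power2_eq_square algebra_simps)
  finally show ?thesis using assms by (simp add: divide_right_mono field_simps)
qed

locale elliptic_chain = finite_chain +
  fixes c\<^sub>1 c\<^sub>2 :: real
  assumes c1_pos: "c\<^sub>1 > 0" and c2_pos: "c\<^sub>2 > 0"
    and pi_ge: "x \<in> V \<Longrightarrow> c\<^sub>1 \<le> \<pi> x * card V"
    and p_ge: "x \<in> V \<Longrightarrow> y \<in> V \<Longrightarrow> 0 < p x y + p y x \<Longrightarrow> c\<^sub>2 \<le> p x y"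
begin

text \<open>
  Every step can be retraced with probability at least \<open>c\<^sub>2\<close>. Loops of length two thus have a
  positive density, and this keeps the logarithmic integral of the limit away from zero.
\<close>

lemma return_sum_two_ge: "c\<^sub>2 * card V \<le> return_sum V p 2"
proof -
  have le: "c\<^sub>2 * p x y \<le> p x y * p y x" if "x \<in> V" "y \<in> V" for x y
  proof (cases "p x y = 0")
    case False
    then show ?thesis
      using p_ge[of y x] p_nonneg[of x y] p_nonneg[of y x] that by simp
  qed simp
  have step1: "step_prob V p (Suc 0) y x = p y x" if "x \<in> V" for x y
    using that fin by (simp add: if_distrib cong: if_cong)
  have "c\<^sub>2 * card V = (\<Sum>x\<in>V. c\<^sub>2 * (\<Sum>y\<in>V. p x y))"
    using p_row_sum by simp
  also have "\<dots> \<le> (\<Sum>x\<in>V. \<Sum>y\<in>V. p x y * p y x)"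
    unfolding sum_distrib_left using le by (intro sum_mono) auto
  also have "\<dots> = return_sum V p 2"
    unfolding return_sum_def numeral_2_eq_2 step_prob.simps(2)[of V p "Suc 0"]
    by (intro sum.cong refl) (simp only: step1)
  finally show ?thesis .
qed

lemma c2_le_1: "c\<^sub>2 \<le> 1"
proof -
  have "c\<^sub>2 * card V \<le> 1 * card V"
    using return_sum_two_ge return_sum_le_card[of 2] by simp
  then show ?thesis using card_pos by simp
qed

text \<open>
  Pairing the equation in \<open>L\<^sup>2(\<pi>)\<close> with the constant \<open>1\<close> shows that \<open>h\<close> has mean zero, and pairing it
  with \<open>h\<close> gives the energy identity \<open>s \<parallel>h\<parallel>\<^sup>2 + E(h) = \<pi> x * h x\<close>, where \<open>E\<close> is the Dirichlet form.
  Having mean zero, \<open>h\<close> is nonpositive somewhere, so \<open>(h x)\<^sup>2\<close> is at most the variation over the edges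
  of the squared positive part of \<open>h\<close>. Each edge carries a weight of at least \<open>c\<^sub>1 * c\<^sub>2 / card V\<close>, and
  Young's inequality bounds the weighted variation by a multiple of the energy identity, whose right
  side is linear in \<open>h x\<close>. The chain has the same Dirichlet form as its additive symmetrization, so
  the argument covers nonreversible chains.
\<close>

lemma killed_poisson_bound:
  fixes h :: "'a \<Rightarrow> real"
  assumes x: "x \<in> V" and s: "s > 0"
    and eq: "\<And>y. y \<in> V \<Longrightarrow> (1 + s) * h y - (\<Sum>z\<in>V. p y z * h z) = (if y = x then 1 else 0) - \<pi> x"
  shows "h x \<le> sqrt 2 / (c\<^sub>1 * c\<^sub>2) * card V * \<pi> x / sqrt s"
proof -
  \<comment> \<open>The squared norm of \<open>h\<close>; the Dirichlet form of \<open>h\<close> is then \<open>Q - R\<close>.\<close>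
  define Q where "Q = (\<Sum>y\<in>V. \<pi> y * (h y)\<^sup>2)"
  define R where "R = (\<Sum>y\<in>V. \<Sum>z\<in>V. \<pi> y * p y z * (h y * h z))"
  let ?E = "{(y, z)\<in>V \<times> V. 0 < p y z}"
  have delta: "(\<Sum>y\<in>V. \<pi> y * f y * (if y = x then 1 else 0)) = \<pi> x * f x" for f :: "'a \<Rightarrow> real"
    using x fin by (simp add: if_distrib cong: if_cong)
  have mean: "(\<Sum>y\<in>V. \<pi> y * h y) = 0"
  proof -
    have "(\<Sum>y\<in>V. \<pi> y * ((1 + s) * h y - (\<Sum>z\<in>V. p y z * h z))) =
          (1 + s) * (\<Sum>y\<in>V. \<pi> y * h y) - (\<Sum>y\<in>V. \<Sum>z\<in>V. \<pi> y * p y z * h z)"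
      by (simp add: right_diff_distrib sum_subtractf sum_distrib_left mult_ac)
    also have "\<dots> = s * (\<Sum>y\<in>V. \<pi> y * h y)"
      by (simp only: stationary_edge_sums) (simp add: algebra_simps)
    finally have "s * (\<Sum>y\<in>V. \<pi> y * h y) =
        (\<Sum>y\<in>V. \<pi> y * ((if y = x then 1 else 0) - \<pi> x))"
      using eq by (simp cong: sum.cong)
    also have "\<dots> = (\<Sum>y\<in>V. \<pi> y * 1 * (if y = x then 1 else 0)) - (\<Sum>y\<in>V. \<pi> y) * \<pi> x"
      by (simp only: right_diff_distrib sum_subtractf sum_distrib_right mult_1_right)
    also have "\<dots> = 0"
      unfolding delta pi_sum by simp
    finally show ?thesis using s by simp
  qed
  have energy: "(1 + s) * Q - R = \<pi> x * h x"
  proof -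
    have "(1 + s) * Q - R = (\<Sum>y\<in>V. \<pi> y * h y * ((1 + s) * h y - (\<Sum>z\<in>V. p y z * h z)))"
      by (simp add: Q_def R_def right_diff_distrib sum_subtractf sum_distrib_left mult_ac power2_eq_square)
    also have "\<dots> = (\<Sum>y\<in>V. \<pi> y * h y * ((if y = x then 1 else 0) - \<pi> x))"
      using eq by (simp cong: sum.cong)
    also have "\<dots> = (\<Sum>y\<in>V. \<pi> y * h y * (if y = x then 1 else 0)) - (\<Sum>y\<in>V. \<pi> y * h y) * \<pi> x"
      by (simp only: right_diff_distrib sum_subtractf sum_distrib_right)
    also have "\<dots> = \<pi> x * h x"
      unfolding delta mean by simp
    finally show ?thesis .
  qed
  have "\<exists>y0\<in>V. h y0 \<le> 0"
  proof (rule ccontr)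
    assume "\<not> ?thesis"
    then have pos: "\<And>y. y \<in> V \<Longrightarrow> h y > 0" by force
    have "\<pi> y * h y = 0" if "y \<in> V" for y
      using mean pos pi_nonneg sum_nonneg_eq_0_iff[OF fin, of "\<lambda>y. \<pi> y * h y"] that
      by (simp add: less_imp_le)
    then have "(\<Sum>y\<in>V. \<pi> y) = 0"
      using pos by (intro sum.neutral) force
    then show False using pi_sum by simp
  qed
  then obtain y0 where y0: "y0 \<in> V" "h y0 \<le> 0" by auto
  show ?thesis
  proof (cases "h x \<le> 0")
    case True
    have "0 \<le> sqrt 2 / (c\<^sub>1 * c\<^sub>2) * card V * \<pi> x / sqrt s"
      using c1_pos c2_pos s pi_nonneg[OF x] by simp
    then show ?thesis using True by linarith
  next
    case False
    \<comment> \<open>With this value \<open>\<alpha> * E(h) + 2 / \<alpha> * \<parallel>h\<parallel>\<^sup>2\<close> is \<open>\<alpha>\<close> times the energy identity.\<close>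
    define \<alpha> where "\<alpha> = sqrt (2 / s)"
    have \<alpha>: "\<alpha> > 0" "2 / \<alpha> = s * \<alpha>"
      using s by (auto simp: \<alpha>_def field_simps real_sqrt_divide)
    define \<phi> where "\<phi> = (\<lambda>y. (max 0 (h y))\<^sup>2)"
    have w: "c\<^sub>1 * c\<^sub>2 / card V \<le> \<pi> y * p y z" if "(y, z) \<in> ?E" for y z
    proof -
      have "c\<^sub>1 / card V \<le> \<pi> y" "c\<^sub>2 \<le> p y z"
        using that pi_ge[of y] p_ge[of y z] p_nonneg[of z y] card_pos by (auto simp: field_simps)
      then have "c\<^sub>1 / card V * c\<^sub>2 \<le> \<pi> y * p y z"
        using c1_pos c2_pos that pi_nonneg by (intro mult_mono) auto
      then show ?thesis by simp
    qed
    have "(h x)\<^sup>2 = \<phi> x - \<phi> y0"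
      using False y0 by (simp add: \<phi>_def)
    then have "c\<^sub>1 * c\<^sub>2 / card V * (h x)\<^sup>2 \<le>
        c\<^sub>1 * c\<^sub>2 / card V * (\<Sum>(y, z)\<in>?E. \<bar>\<phi> y - \<phi> z\<bar>)"
      using difference_le_edge_sum[OF x y0(1), of \<phi>] c1_pos c2_pos
      by (intro mult_left_mono) auto
    also have "\<dots> \<le> (\<Sum>(y, z)\<in>?E. \<pi> y * p y z * \<bar>\<phi> y - \<phi> z\<bar>)"
      unfolding sum_distrib_left using w by (intro sum_mono) (auto intro!: mult_right_mono simp del: times_divide_eq_left)
    also have "\<dots> \<le> (\<Sum>(y, z)\<in>V \<times> V. \<pi> y * p y z * \<bar>\<phi> y - \<phi> z\<bar>)"
      using fin by (intro sum_mono2) (auto intro!: mult_nonneg_nonneg pi_nonneg p_nonneg)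
    also have "\<dots> = (\<Sum>y\<in>V. \<Sum>z\<in>V. \<pi> y * p y z * \<bar>\<phi> y - \<phi> z\<bar>)"
      by (simp add: sum.cartesian_product)
    also have "\<dots> \<le> (\<Sum>y\<in>V. \<Sum>z\<in>V. \<pi> y * p y z *
        (\<alpha> / 2 * (h y - h z)\<^sup>2 + 1 / \<alpha> * ((h y)\<^sup>2 + (h z)\<^sup>2)))"
      using square_diff_young[OF \<alpha>(1)] unfolding \<phi>_def
      by (intro sum_mono mult_left_mono) (auto intro!: mult_nonneg_nonneg pi_nonneg p_nonneg)
    also have "\<dots> = (\<Sum>y\<in>V. \<Sum>z\<in>V. (\<alpha> / 2 + 1 / \<alpha>) * (\<pi> y * p y z * (h y)\<^sup>2)
        + (\<alpha> / 2 + 1 / \<alpha>) * (\<pi> y * p y z * (h z)\<^sup>2) - \<alpha> * (\<pi> y * p y z * (h y * h z)))"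
      by (intro sum.cong) (auto simp: algebra_simps power2_eq_square)
    also have "\<dots> = (\<alpha> / 2 + 1 / \<alpha>) * Q + (\<alpha> / 2 + 1 / \<alpha>) * Q - \<alpha> * R"
      using stationary_edge_sums[of "\<lambda>y. (h y)\<^sup>2"]
      by (simp add: sum.distrib sum_subtractf sum_distrib_left[symmetric] Q_def R_def)
    also have "\<dots> = \<alpha> * Q + (2 / \<alpha>) * Q - \<alpha> * R"
      by (simp add: algebra_simps)
    also have "\<dots> = \<alpha> * ((1 + s) * Q - R)"
      unfolding \<alpha>(2) by (simp add: algebra_simps)
    also have "\<dots> = \<alpha> * \<pi> x * h x"
      unfolding energy by simp
    finally have "(c\<^sub>1 * c\<^sub>2 / card V * h x) * h x \<le> (\<alpha> * \<pi> x) * h x"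
      by (simp only: power2_eq_square mult.assoc)
    then have "c\<^sub>1 * c\<^sub>2 / card V * h x \<le> \<alpha> * \<pi> x"
      using False by (simp add: mult_le_cancel_right del: times_divide_eq_left)
    then have "h x \<le> \<alpha> * \<pi> x * card V / (c\<^sub>1 * c\<^sub>2)"
      using c1_pos c2_pos card_pos by (simp add: field_simps)
    then show ?thesis by (simp add: \<alpha>_def real_sqrt_divide mult_ac)
  qed
qed

end

section \<open>The resolvent trace and the eigenvalues near one\<close>

lemma sums_sum_mset:
  fixes f :: "'b \<Rightarrow> nat \<Rightarrow> 'c :: real_normed_vector"
  assumes "\<And>z. z \<in># M \<Longrightarrow> f z sums g z"
  shows "(\<lambda>k. \<Sum>z\<in>#M. f z k) sums (\<Sum>z\<in>#M. g z)"
  using assms by (induction M) (auto intro!: sums_add)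

lemma Re_sum_mset: "Re (\<Sum>z\<in>#M. f z) = (\<Sum>z\<in>#M. Re (f z))"
  by (induction M) auto

lemma inverse_series_sums:
  fixes z :: complex and s :: real
  assumes "cmod z \<le> 1" "s > 0"
  shows "(\<lambda>k. z ^ k * complex_of_real ((1 / (1 + s)) ^ Suc k)) sums inverse (complex_of_real s + (1 - z))"
proof -
  define r where "r = 1 / (1 + s)"
  have r: "0 < r" "r < 1" "(1 + s) * r = 1" using assms by (auto simp: r_def)
  have rc: "(1 + complex_of_real s) * complex_of_real r = 1"
    using r(3) by (metis of_real_1 of_real_add of_real_mult)
  have "cmod (z * r) = cmod z * r" using r by (simp add: norm_mult)
  also have "\<dots> \<le> 1 * r" using assms r by (intro mult_right_mono) auto
  finally have "cmod (z * r) < 1" using r by simp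
  then have "(\<lambda>k. complex_of_real r * (z * complex_of_real r) ^ k) sums (complex_of_real r * (1 / (1 - z * complex_of_real r)))"
    by (intro sums_mult geometric_sums)
  moreover have "complex_of_real r * (1 / (1 - z * complex_of_real r)) = inverse (complex_of_real s + (1 - z))"
  proof -
    have "1 - z * complex_of_real r = (complex_of_real s + (1 - z)) * complex_of_real r"
      using rc by (simp add: algebra_simps)
    then show ?thesis using r by (simp add: divide_inverse)
  qed
  moreover have "complex_of_real r * (z * complex_of_real r) ^ k = z ^ k * complex_of_real (r ^ Suc k)" for k
    by (simp add: power_mult_distrib)
  ultimately show ?thesis unfolding r_def[symmetric] by (simp only:)
qed

lemma Ln_series_sums:
  fixes z :: complex and c :: real
  assumes "cmod z \<le> 1" "c > 0"
  shows "(\<lambda>k. z ^ k * complex_of_real (inverse ((1 + c) ^ k) / k)) sums (- Ln (1 - z / complex_of_real (1 + c)))"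
proof -
  define w where "w = z / complex_of_real (1 + c)"
  have nc: "cmod (complex_of_real (1 + c)) = 1 + c" using assms by (simp only: norm_of_real)
  have "cmod w < 1"
    unfolding w_def norm_divide nc using assms by simp
  then have "(\<lambda>n. - ((- (-w)) ^ n) / of_nat n) sums Ln (1 + (-w))"
    by (intro Ln_series') simp
  from sums_minus[OF this] have "(\<lambda>n. w ^ n / of_nat n) sums (- Ln (1 - w))" by simp
  moreover have "w ^ n / of_nat n = z ^ n * complex_of_real (inverse ((1 + c) ^ n) / n)" for n
    by (simp add: w_def power_mult_distrib power_inverse divide_inverse mult_ac)
  ultimately show ?thesis unfolding w_def by (simp only:)
qed

lemma log_series_sums:
  fixes z :: complex and c :: real
  assumes "cmod z \<le> 1" "c > 0"
  shows "(\<lambda>k. Re (z ^ k) / k * inverse ((1 + c) ^ k)) sums (ln (1 + c) - ln (cmod (complex_of_real c + (1 - z))))"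
proof -
  let ?w = "z / complex_of_real (1 + c)"
  have nc: "cmod (complex_of_real (1 + c)) = 1 + c" using assms by (simp only: norm_of_real)
  have "cmod ?w < 1"
    unfolding norm_divide nc using assms by simp
  then have ne: "1 - ?w \<noteq> 0" by auto
  have "1 - ?w = (complex_of_real c + (1 - z)) / complex_of_real (1 + c)"
    using assms nc by (simp add: field_simps del: of_real_add) (auto simp: algebra_simps)
  then have nw: "cmod (1 - ?w) = cmod (complex_of_real c + (1 - z)) / (1 + c)"
    by (simp only: norm_divide nc)
  have pos: "cmod (complex_of_real c + (1 - z)) > 0"
    using ne nw assms by (metis div_0 zero_less_norm_iff norm_eq_zero)
  have "- Re (Ln (1 - ?w)) = ln (1 + c) - ln (cmod (complex_of_real c + (1 - z)))"
    unfolding Re_Ln[OF ne] nw using pos assms by (simp add: ln_div)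
  moreover have "Re (z ^ k * complex_of_real (inverse ((1 + c) ^ k) / k)) =
      Re (z ^ k) / k * inverse ((1 + c) ^ k)" for k
  proof -
    have "Re (u * complex_of_real t) = Re u * t" for u t by simp
    then show ?thesis by (simp only:) simp
  qed
  ultimately show ?thesis
    using sums_Re[OF Ln_series_sums[OF assms]] by (simp only: uminus_complex.sel)
qed

text \<open>
  A single copy of the eigenvalue \<open>1\<close> is removed, whatever its multiplicity, so exactly \<open>card V - 1\<close>
  eigenvalues remain. A second copy would violate the resolvent bound below as \<open>s\<close> tends to \<open>0\<close>.
\<close>

definition other_eigenvalues :: "'a set \<Rightarrow> ('a \<Rightarrow> 'a \<Rightarrow> real) \<Rightarrow> complex multiset" where
  "other_eigenvalues V p = eigenvalues V p - {#1#}"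

context finite_chain
begin

lemma state_enum_in: "i < card V \<Longrightarrow> state_enum V i \<in> V"
  using state_enum_bij[OF fin] by (auto simp: bij_betw_def)

lemma p_row_sum_enum: "i < card V \<Longrightarrow> (\<Sum>j<card V. p (state_enum V i) (state_enum V j)) = 1"
  using sum.reindex_bij_betw[OF state_enum_bij[OF fin], of "p (state_enum V i)"]
    p_row_sum[OF state_enum_in] by simp

text \<open>
  Read the eigenvector equation at a coordinate of maximal modulus.
\<close>

lemma norm_eigenvalue_le_1:
  assumes "z \<in># eigenvalues V p"
  shows "cmod z \<le> 1"
proof -
  let ?N = "card V"
  obtain v where v: "v \<in> carrier_vec ?N" "v \<noteq> 0\<^sub>v ?N" "matrix_of V p *\<^sub>v v = z \<cdot>\<^sub>v v"
    using assms unfolding eigenvalues_iff eigenvalue_def eigenvector_def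
    by (auto simp: matrix_of_def)
  define m where "m = Max ((\<lambda>j. cmod (v $ j)) ` {..<?N})"
  have "m \<in> (\<lambda>j. cmod (v $ j)) ` {..<?N}"
    unfolding m_def using card_pos by (intro Max_in) auto
  then obtain i where i: "i < ?N" "m = cmod (v $ i)" by auto
  have le: "cmod (v $ j) \<le> m" if "j < ?N" for j
    unfolding m_def using that by (intro Max_ge) auto
  have "m \<noteq> 0"
  proof
    assume "m = 0"
    then have "v $ j = 0" if "j < ?N" for j using le[OF that] by simp
    then have "v = 0\<^sub>v ?N" using v(1) by (intro eq_vecI) auto
    then show False using v(2) by simp
  qed
  then have m: "m > 0" using i by simp
  have "z * v $ i = (matrix_of V p *\<^sub>v v) $ i"
    using v i by simp
  also have "\<dots> = (\<Sum>j<?N. complex_of_real (p (state_enum V i) (state_enum V j)) * v $ j)"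
    using v(1) i by (simp add: matrix_of_def scalar_prod_def atLeast0LessThan)
  finally have "cmod z * m = cmod (\<Sum>j<?N. complex_of_real (p (state_enum V i) (state_enum V j)) * v $ j)"
    using i by (metis norm_mult)
  also have "\<dots> \<le> (\<Sum>j<?N. p (state_enum V i) (state_enum V j) * m)"
    using le i p_nonneg[OF state_enum_in state_enum_in]
    by (intro sum_norm_le) (auto simp: norm_mult intro!: mult_left_mono)
  also have "\<dots> = m" using p_row_sum_enum[OF i(1)] by (simp add: sum_distrib_right[symmetric])
  finally show ?thesis using m by simp
qed

lemma one_in_eigenvalues: "1 \<in># eigenvalues V p"
proof -
  let ?N = "card V"
  define v where "v = vec ?N (\<lambda>_. 1 :: complex)"
  have "matrix_of V p *\<^sub>v v = 1 \<cdot>\<^sub>v v"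
  proof (rule eq_vecI)
    fix i assume "i < dim_vec (1 \<cdot>\<^sub>v v)"
    then have i: "i < ?N" by (simp add: v_def)
    have "(matrix_of V p *\<^sub>v v) $ i = complex_of_real (\<Sum>j<?N. p (state_enum V i) (state_enum V j))"
      using i by (simp add: matrix_of_def v_def scalar_prod_def atLeast0LessThan)
    also have "\<dots> = (1 \<cdot>\<^sub>v v) $ i"
      using i p_row_sum_enum[OF i] by (simp add: v_def)
    finally show "(matrix_of V p *\<^sub>v v) $ i = (1 \<cdot>\<^sub>v v) $ i" .
  qed (simp add: matrix_of_def v_def)
  moreover have "v \<noteq> 0\<^sub>v ?N"
  proof
    assume "v = 0\<^sub>v ?N"
    then have "v $ 0 = 0\<^sub>v ?N $ 0" by simp
    then show False using card_pos by (simp add: v_def)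
  qed
  ultimately have "eigenvector (matrix_of V p) v 1"
    by (simp add: eigenvector_def matrix_of_def v_def)
  then show ?thesis unfolding eigenvalues_iff eigenvalue_def by auto
qed

lemma sum_eigenvalues_split:
  fixes f :: "complex \<Rightarrow> 'b :: comm_monoid_add"
  shows "(\<Sum>z\<in>#eigenvalues V p. f z) = f 1 + (\<Sum>z\<in>#other_eigenvalues V p. f z)"
proof -
  have "eigenvalues V p = add_mset 1 (other_eigenvalues V p)"
    using one_in_eigenvalues by (simp add: other_eigenvalues_def)
  then show ?thesis by simp
qed

lemma other_eigenvalue_norm_le_1: "z \<in># other_eigenvalues V p \<Longrightarrow> cmod z \<le> 1"
  using norm_eigenvalue_le_1 by (auto simp: other_eigenvalues_def dest: in_diffD)

text \<open>
  The left side is the expansion of \<open>- ln det (1 - p / (1 + c))\<close> in traces of powers.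
\<close>

lemma log_det_sums:
  assumes "c > 0"
  shows "(\<lambda>k. return_sum V p k / k * inverse ((1 + c) ^ k)) sums
    (card V * ln (1 + c) - (\<Sum>z\<in>#eigenvalues V p. ln (cmod (complex_of_real c + (1 - z)))))"
proof -
  have "(\<lambda>k. \<Sum>z\<in>#eigenvalues V p. Re (z ^ k) / k * inverse ((1 + c) ^ k)) sums
      (\<Sum>z\<in>#eigenvalues V p. ln (1 + c) - ln (cmod (complex_of_real c + (1 - z))))"
    using log_series_sums[OF norm_eigenvalue_le_1 assms] by (intro sums_sum_mset) auto
  moreover have "(\<Sum>z\<in>#eigenvalues V p. Re (z ^ k) / k * inverse ((1 + c) ^ k)) =
      return_sum V p k / k * inverse ((1 + c) ^ k)" for k
  proof -
    have "return_sum V p k = Re (\<Sum>z\<in>#eigenvalues V p. z ^ k)"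
      using return_sum_eq_power_sum[OF fin, of p k] by (metis Re_complex_of_real)
    then show ?thesis
      by (simp add: Re_sum_mset sum_mset_distrib_right[symmetric] divide_inverse)
  qed
  moreover have "(\<Sum>z\<in>#eigenvalues V p. ln (1 + c) - ln (cmod (complex_of_real c + (1 - z)))) =
      card V * ln (1 + c) - (\<Sum>z\<in>#eigenvalues V p. ln (cmod (complex_of_real c + (1 - z))))"
  proof -
    have "(\<Sum>z\<in>#M. b - f z) = size M * b - (\<Sum>z\<in>#M. f z)" for M :: "complex multiset" and b :: real and f
      by (induction M) (auto simp: algebra_simps)
    then show ?thesis by (simp add: size_eigenvalues)
  qed
  ultimately show ?thesis by simp
qed

text \<open>
  The logarithms add up to a power series whose coefficients are traces of powers of a real matrix.
\<close>

lemma sum_Im_Ln_eq_0: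
  assumes "c > 0"
  shows "(\<Sum>z\<in>#eigenvalues V p. Im (Ln (1 - z / complex_of_real (1 + c)))) = 0"
proof -
  have "(\<lambda>k. Im (\<Sum>z\<in>#eigenvalues V p. z ^ k * complex_of_real (inverse ((1 + c) ^ k) / k))) sums
      Im (\<Sum>z\<in>#eigenvalues V p. - Ln (1 - z / complex_of_real (1 + c)))"
    using Ln_series_sums[OF norm_eigenvalue_le_1 assms] by (intro sums_Im sums_sum_mset) auto
  moreover have "Im (\<Sum>z\<in>#eigenvalues V p. z ^ k * complex_of_real (inverse ((1 + c) ^ k) / k)) = 0" for k
    unfolding sum_mset_distrib_right[symmetric] return_sum_eq_power_sum[OF fin, symmetric]
    by (simp only: of_real_mult[symmetric] Im_complex_of_real)
  ultimately have "Im (\<Sum>z\<in>#eigenvalues V p. - Ln (1 - z / complex_of_real (1 + c))) = 0"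
    using sums_unique2[of "\<lambda>_. 0" _ 0] by simp
  moreover have "Im (\<Sum>z\<in>#M. - f z) = - (\<Sum>z\<in>#M. Im (f z))" for M :: "complex multiset" and f
    by (induction M) auto
  ultimately show ?thesis by simp
qed

text \<open>
  The kernel of the inverse of \<open>s + 1 - p\<close>, written as a Neumann series.
\<close>

definition green :: "real \<Rightarrow> 'a \<Rightarrow> 'a \<Rightarrow> real" where
  "green s y x = (\<Sum>k. step_prob V p k y x * (1 / (1 + s)) ^ Suc k)"

lemma green_summable:
  assumes "s > 0" "x \<in> V" "y \<in> V"
  shows "summable (\<lambda>k. step_prob V p k y x * (1 / (1 + s)) ^ Suc k)"
proof (rule summable_comparison_test')
  show "summable (\<lambda>k. (1 / (1 + s)) ^ Suc k)"
    using assms by (simp only: summable_Suc_iff) (simp add: summable_geometric)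
  show "norm (step_prob V p k y x * (1 / (1 + s)) ^ Suc k) \<le> (1 / (1 + s)) ^ Suc k" for k
  proof -
    have "step_prob V p k y x * (1 / (1 + s)) ^ Suc k \<le> 1 * (1 / (1 + s)) ^ Suc k"
      using assms step_prob_le_1 by (intro mult_right_mono) auto
    then show ?thesis using assms step_prob_nonneg by (simp add: abs_mult)
  qed
qed

lemma green_equation:
  assumes s: "s > 0" and x: "x \<in> V" and y: "y \<in> V"
  shows "(1 + s) * green s y x - (\<Sum>z\<in>V. p y z * green s z x) = (if y = x then 1 else 0)"
proof -
  define r where "r = 1 / (1 + s)"
  have r: "(1 + s) * r = 1" using s by (simp add: r_def)
  note summ = green_summable[OF s x, folded r_def]
  have "(\<Sum>k. step_prob V p (Suc k) y x * r ^ Suc (Suc k)) = green s y x - step_prob V p 0 y x * r"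
    using suminf_split_head[OF summ[OF y]] by (simp add: green_def r_def)
  moreover have "(\<Sum>k. step_prob V p (Suc k) y x * r ^ Suc (Suc k)) =
      (\<Sum>k. \<Sum>z\<in>V. r * p y z * (step_prob V p k z x * r ^ Suc k))"
    by (simp add: sum_distrib_right sum_distrib_left mult_ac)
  moreover have "\<dots> = (\<Sum>z\<in>V. \<Sum>k. r * p y z * (step_prob V p k z x * r ^ Suc k))"
    using summ by (intro suminf_sum summable_mult) auto
  moreover have "\<dots> = (\<Sum>z\<in>V. r * p y z * green s z x)"
    unfolding green_def r_def[symmetric] by (intro sum.cong refl suminf_mult summ)
  ultimately have "r * (\<Sum>z\<in>V. p y z * green s z x) = green s y x - (if y = x then 1 else 0) * r"
    by (simp add: sum_distrib_left mult.assoc)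
  then have "(1 + s) * (r * (\<Sum>z\<in>V. p y z * green s z x)) = (1 + s) * (green s y x - (if y = x then 1 else 0) * r)"
    by simp
  then have "((1 + s) * r) * (\<Sum>z\<in>V. p y z * green s z x) = (1 + s) * green s y x - (if y = x then 1 else 0) * ((1 + s) * r)"
    by (simp only: right_diff_distrib mult_ac)
  then show ?thesis unfolding r by simp
qed

text \<open>
  Both sides are the trace of the inverse of \<open>s + 1 - p\<close>; the eigenvalue \<open>1\<close> contributes \<open>1 / s\<close>.
\<close>

lemma green_trace:
  assumes s: "s > 0"
  shows "(\<Sum>x\<in>V. green s x x) = 1 / s + (\<Sum>z\<in>#other_eigenvalues V p. Re (inverse (complex_of_real s + (1 - z))))"
proof -
  have "(\<lambda>k. \<Sum>x\<in>V. step_prob V p k x x * (1 / (1 + s)) ^ Suc k) sums (\<Sum>x\<in>V. green s x x)"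
    using green_summable[OF s] unfolding green_def by (intro sums_sum summable_sums) auto
  moreover have "(\<lambda>k. Re (\<Sum>z\<in>#eigenvalues V p. z ^ k * complex_of_real ((1 / (1 + s)) ^ Suc k))) sums
      Re (\<Sum>z\<in>#eigenvalues V p. inverse (complex_of_real s + (1 - z)))"
    using inverse_series_sums[OF norm_eigenvalue_le_1 s] by (intro sums_Re sums_sum_mset) auto
  moreover have "Re (\<Sum>z\<in>#eigenvalues V p. z ^ k * complex_of_real ((1 / (1 + s)) ^ Suc k)) =
      (\<Sum>x\<in>V. step_prob V p k x x * (1 / (1 + s)) ^ Suc k)" for k
  proof -
    have "(\<Sum>z\<in>#eigenvalues V p. z ^ k * complex_of_real ((1 / (1 + s)) ^ Suc k)) =
        complex_of_real (return_sum V p k * (1 / (1 + s)) ^ Suc k)"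
      unfolding of_real_mult return_sum_eq_power_sum[OF fin] by (simp only: sum_mset_distrib_right)
    then have "Re (\<Sum>z\<in>#eigenvalues V p. z ^ k * complex_of_real ((1 / (1 + s)) ^ Suc k)) =
        return_sum V p k * (1 / (1 + s)) ^ Suc k"
      by (simp only: Re_complex_of_real)
    then show ?thesis unfolding return_sum_def sum_distrib_right .
  qed
  ultimately have "(\<Sum>x\<in>V. green s x x) = Re (\<Sum>z\<in>#eigenvalues V p. inverse (complex_of_real s + (1 - z)))"
    using sums_unique2 by simp
  also have "\<dots> = Re (inverse (complex_of_real s)) + (\<Sum>z\<in>#other_eigenvalues V p. Re (inverse (complex_of_real s + (1 - z))))"
    by (simp add: sum_eigenvalues_split Re_sum_mset)
  also have "Re (inverse (complex_of_real s)) = 1 / s"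
    by (metis Re_complex_of_real of_real_inverse inverse_eq_divide)
  finally show ?thesis .
qed

end

context elliptic_chain
begin

text \<open>
  Subtracting \<open>\<pi> x / s\<close> from the Green function removes its component along the constants, and the
  remainder solves the killed Poisson equation. Summed over \<open>x\<close>, the pointwise bounds give the order
  \<open>card V / sqrt s\<close>. An eigenvalue within distance \<open>s\<close> of \<open>1\<close> contributes at least \<open>1 / (2 * s)\<close> to the
  left side, so only of the order of \<open>card V * sqrt s\<close> eigenvalues can be that close to \<open>1\<close>.
\<close>

lemma resolvent_trace_bound:
  assumes s: "s > 0"
  shows "(\<Sum>z\<in>#other_eigenvalues V p. Re (inverse (complex_of_real s + (1 - z)))) \<le>
           sqrt 2 / (c\<^sub>1 * c\<^sub>2) * card V / sqrt s"
proof -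
  have bound: "green s x x - \<pi> x / s \<le> sqrt 2 / (c\<^sub>1 * c\<^sub>2) * card V * \<pi> x / sqrt s" if x: "x \<in> V" for x
  proof (rule killed_poisson_bound[where h = "\<lambda>y. green s y x - \<pi> x / s", OF x s])
    fix y assume y: "y \<in> V"
    have "(\<Sum>z\<in>V. p y z * (green s z x - \<pi> x / s)) =
        (\<Sum>z\<in>V. p y z * green s z x) - (\<Sum>z\<in>V. p y z) * (\<pi> x / s)"
      by (simp only: right_diff_distrib sum_subtractf sum_distrib_right)
    then have "(1 + s) * (green s y x - \<pi> x / s) - (\<Sum>z\<in>V. p y z * (green s z x - \<pi> x / s)) =
        ((1 + s) * green s y x - (\<Sum>z\<in>V. p y z * green s z x)) - s * (\<pi> x / s)"
      unfolding p_row_sum[OF y] by (simp only: distrib_right right_diff_distrib)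
    then show "(1 + s) * (green s y x - \<pi> x / s) - (\<Sum>z\<in>V. p y z * (green s z x - \<pi> x / s)) =
        (if y = x then 1 else 0) - \<pi> x"
      using green_equation[OF s x y] s by simp
  qed
  have "(\<Sum>x\<in>V. green s x x - \<pi> x / s) = (\<Sum>z\<in>#other_eigenvalues V p. Re (inverse (complex_of_real s + (1 - z))))"
    using green_trace[OF s] pi_sum by (simp add: sum_subtractf sum_divide_distrib[symmetric])
  moreover have "(\<Sum>x\<in>V. green s x x - \<pi> x / s) \<le> (\<Sum>x\<in>V. sqrt 2 / (c\<^sub>1 * c\<^sub>2) * card V * \<pi> x / sqrt s)"
    using bound by (intro sum_mono)
  moreover have "(\<Sum>x\<in>V. sqrt 2 / (c\<^sub>1 * c\<^sub>2) * card V * \<pi> x / sqrt s) = sqrt 2 / (c\<^sub>1 * c\<^sub>2) * card V / sqrt s"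
    using pi_sum by (simp only: sum_divide_distrib[symmetric] sum_distrib_left[symmetric] mult_1_right)
  ultimately show ?thesis by simp
qed

text \<open>
  The derivative of \<open>ln \<bar>s + (1 - z)\<bar>\<close> in \<open>s\<close> is the real part of the inverse, so this is the previous
  bound integrated from \<open>\<delta>\<close> to \<open>\<epsilon>\<close>. As \<open>1 / sqrt s\<close> is integrable at \<open>0\<close>, the logarithmic singularity at \<open>1\<close>
  can be cut off at the level \<open>\<epsilon>\<close> with an error per state of the order of \<open>sqrt \<epsilon>\<close>, uniformly over
  all chains with the same \<open>c\<^sub>1\<close> and \<open>c\<^sub>2\<close>.
\<close>

lemma log_truncation_bound:
  assumes "0 < \<delta>" "\<delta> \<le> \<epsilon>"
  shows "(\<Sum>z\<in>#other_eigenvalues V p. ln (cmod (complex_of_real \<epsilon> + (1 - z)))) -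
         (\<Sum>z\<in>#other_eigenvalues V p. ln (cmod (complex_of_real \<delta> + (1 - z))))
         \<le> 2 * (sqrt 2 / (c\<^sub>1 * c\<^sub>2)) * card V * (sqrt \<epsilon> - sqrt \<delta>)"
proof -
  let ?D = "\<lambda>s. 2 * (sqrt 2 / (c\<^sub>1 * c\<^sub>2)) * card V * sqrt s -
    (\<Sum>z\<in>#other_eigenvalues V p. ln (cmod (complex_of_real s + (1 - z))))"
  have deriv1: "((\<lambda>s. ln (cmod (complex_of_real s + (1 - z)))) has_real_derivative
      Re (inverse (complex_of_real s + (1 - z)))) (at s)" if "cmod z \<le> 1" "s > 0" for s z
  proof -
    have "Re z \<le> 1" using that complex_Re_le_cmod[of z] by linarith
    then have pos: "0 < s + (1 - Re z)" using that by simp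
    then have pos2: "0 < (s + (1 - Re z))\<^sup>2 + (Im z)\<^sup>2" by (simp add: add_pos_nonneg)
    have eq: "ln (cmod (complex_of_real s + (1 - z))) = ln ((s + (1 - Re z))\<^sup>2 + (Im z)\<^sup>2) / 2" for s
      unfolding cmod_def by (cases "(s + (1 - Re z))\<^sup>2 + (Im z)\<^sup>2 = 0") (auto simp: ln_sqrt add_nonneg_nonneg add.commute)
    show ?thesis
      unfolding eq
    proof (rule DERIV_cong)
      show "((\<lambda>s. ln ((s + (1 - Re z))\<^sup>2 + (Im z)\<^sup>2) / 2) has_real_derivative
          1 / ((s + (1 - Re z))\<^sup>2 + (Im z)\<^sup>2) * (2 * (s + (1 - Re z))) / 2) (at s)"
        by (intro DERIV_cdivide DERIV_chain2[where f = ln] DERIV_ln_divide[OF pos2])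
          (auto intro!: derivative_eq_intros)
      have "1 / d * (2 * a) / 2 = a / d" for a d :: real by simp
      moreover have "Re (inverse (complex_of_real s + (1 - z))) =
          (s + (1 - Re z)) / ((s + (1 - Re z))\<^sup>2 + (Im z)\<^sup>2)" by simp
      ultimately show "1 / ((s + (1 - Re z))\<^sup>2 + (Im z)\<^sup>2) * (2 * (s + (1 - Re z))) / 2 =
          Re (inverse (complex_of_real s + (1 - z)))" by (simp only:)
    qed
  qed
  have deriv: "((\<lambda>s. \<Sum>z\<in>#M. ln (cmod (complex_of_real s + (1 - z)))) has_real_derivative
      (\<Sum>z\<in>#M. Re (inverse (complex_of_real s + (1 - z))))) (at s)"
    if "\<And>z. z \<in># M \<Longrightarrow> cmod z \<le> 1" "s > 0" for M s
    using that
  proof (induction M)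
    case (add x M)
    then show ?case
      unfolding image_mset_add_mset sum_mset.add_mset by (intro DERIV_add deriv1) auto
  qed simp
  have "?D \<delta> \<le> ?D \<epsilon>"
  proof (rule DERIV_nonneg_imp_nondecreasing[OF assms(2)])
    fix s assume "\<delta> \<le> s" "s \<le> \<epsilon>"
    then have s: "s > 0" using assms by simp
    have "(?D has_real_derivative (2 * (sqrt 2 / (c\<^sub>1 * c\<^sub>2)) * card V * (inverse (sqrt s) / 2) -
        (\<Sum>z\<in>#other_eigenvalues V p. Re (inverse (complex_of_real s + (1 - z)))))) (at s)"
      using s other_eigenvalue_norm_le_1
      by (intro DERIV_diff DERIV_cmult DERIV_real_sqrt deriv) auto
    moreover have "0 \<le> 2 * (sqrt 2 / (c\<^sub>1 * c\<^sub>2)) * card V * (inverse (sqrt s) / 2) -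
        (\<Sum>z\<in>#other_eigenvalues V p. Re (inverse (complex_of_real s + (1 - z))))"
    proof -
      have eq: "2 * K * N * (inverse r / 2) = K * N / r" for K N r :: real
        by (simp add: inverse_eq_divide)
      show ?thesis unfolding eq unfolding diff_ge_0_iff_ge by (rule resolvent_trace_bound[OF s])
    qed
    ultimately show "\<exists>y. (?D has_real_derivative y) (at s) \<and> 0 \<le> y" by (intro exI conjI)
  qed
  then show ?thesis unfolding right_diff_distrib by linarith
qed

end

section \<open>The mass of loops by length\<close>

primrec path_weight :: "('a \<Rightarrow> 'a \<Rightarrow> real) \<Rightarrow> 'a \<Rightarrow> 'a list \<Rightarrow> 'a \<Rightarrow> real" where
  "path_weight p x [] y = p x y"
| "path_weight p x (z # zs) y = p x z * path_weight p z zs y"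

lemma path_weight_eq_prod:
  "path_weight p x zs y = (\<Prod>i<Suc (length zs). p ((x # zs) ! i) ((zs @ [y]) ! i))"
proof (induction zs arbitrary: x)
  case (Cons z zs)
  show ?case
    by (simp only: path_weight.simps Cons.IH list.size add_0_right add_Suc_right prod.lessThan_Suc_shift[of _ "Suc (length zs)"]) simp
qed simp

lemma loop_weight_eq_path_weight:
  "(\<Prod>i<length (x # zs). p ((x # zs) ! i) ((x # zs) ! (Suc i mod length (x # zs)))) = path_weight p x zs x"
  unfolding path_weight_eq_prod
proof (intro prod.cong)
  fix i assume "i \<in> {..<Suc (length zs)}"
  then show "p ((x # zs) ! i) ((x # zs) ! (Suc i mod length (x # zs))) = p ((x # zs) ! i) ((zs @ [x]) ! i)"
    by (cases "i = length zs") (auto simp: nth_append)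
qed simp

lemma sum_lists_Suc:
  assumes "finite V"
  shows "(\<Sum>xs | set xs \<subseteq> V \<and> length xs = Suc k. f xs) =
    (\<Sum>x\<in>V. \<Sum>zs | set zs \<subseteq> V \<and> length zs = k. f (x # zs))"
proof -
  have "(\<Sum>xs | set xs \<subseteq> V \<and> length xs = Suc k. f xs) =
      (\<Sum>(zs, x)\<in>{zs. set zs \<subseteq> V \<and> length zs = k} \<times> V. f (x # zs))"
    unfolding lists_length_Suc_eq by (subst sum.reindex) (auto simp: inj_on_def case_prod_unfold)
  also have "\<dots> = (\<Sum>x\<in>V. \<Sum>zs | set zs \<subseteq> V \<and> length zs = k. f (x # zs))"
    by (subst sum.cartesian_product[symmetric]) (rule sum.swap)
  finally show ?thesis .
qed

lemma sum_path_weights: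
  assumes "finite V" "y \<in> V"
  shows "(\<Sum>zs | set zs \<subseteq> V \<and> length zs = k. path_weight p x zs y) = step_prob V p (Suc k) x y"
proof (induction k arbitrary: x)
  case 0
  have "{zs :: 'a list. set zs \<subseteq> V \<and> length zs = 0} = {[]}" by auto
  then show ?case using assms by (simp add: if_distrib cong: if_cong)
next
  case (Suc k)
  have "(\<Sum>zs | set zs \<subseteq> V \<and> length zs = Suc k. path_weight p x zs y) =
      (\<Sum>z\<in>V. p x z * (\<Sum>zs | set zs \<subseteq> V \<and> length zs = k. path_weight p z zs y))"
    unfolding sum_lists_Suc[OF assms(1)] by (simp add: sum_distrib_left)
  then show ?case unfolding Suc.IH by simp
qed

text \<open>
  A based loop is a closed path, cut open at its base point.
\<close>

lemma sum_loop_weights: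
  assumes "finite V"
  shows "(\<Sum>xs | set xs \<subseteq> V \<and> length xs = Suc k.
      \<Prod>i<length xs. p (xs ! i) (xs ! (Suc i mod length xs))) = return_sum V p (Suc k)"
  unfolding sum_lists_Suc[OF assms] loop_weight_eq_path_weight return_sum_def
  by (intro sum.cong refl sum_path_weights assms)

definition length_mass :: "'a set \<Rightarrow> ('a \<Rightarrow> 'a \<Rightarrow> real) \<Rightarrow> real \<Rightarrow> nat \<Rightarrow> real" where
  "length_mass V p c k = return_sum V p k / k * inverse ((1 + c) ^ k)"

definition mass_of_lengths :: "'a set \<Rightarrow> ('a \<Rightarrow> 'a \<Rightarrow> real) \<Rightarrow> real \<Rightarrow> (nat \<Rightarrow> bool) \<Rightarrow> real" where
  "mass_of_lengths V p c Q = (\<Sum>k. if Q k then length_mass V p c k else 0)"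

lemma loop_length_class:
  assumes "xs \<in> based_loops V"
  shows "loop_length (loop_rel V `` {xs}) = length xs"
  unfolding loop_length_def
proof (rule the_equality)
  have "xs \<in> loop_rel V `` {xs}"
    using assms unfolding loop_rel_def by (auto intro: exI[of _ 0])
  then show "k = length xs" if "\<forall>ys\<in>loop_rel V `` {xs}. length ys = k" for k
    using that by auto
qed (auto simp: loop_rel_def)

lemma space_loop_measure [simp]: "space (loop_measure V p c) = loops V"
  and sets_loop_measure [simp]: "sets (loop_measure V p c) = Pow (loops V)"
  by (auto simp: loop_measure_def)

lemma sum_count_eq_sum_mset:
  fixes f :: "'b \<Rightarrow> real"
  assumes "finite S" "set_mset M \<subseteq> S"
  shows "(\<Sum>z\<in>S. count M z * f z) = (\<Sum>z\<in>#M. f z)"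
  using assms(2)
proof (induction M)
  case (add x M)
  have "(\<Sum>z\<in>S. count (add_mset x M) z * f z) = (\<Sum>z\<in>S. count M z * f z + (if z = x then f z else 0))"
    by (intro sum.cong) (auto simp: algebra_simps)
  then show ?case using add assms(1) by (simp add: sum.distrib)
qed simp

context finite_chain
begin

lemma length_mass_nonneg: "c > 0 \<Longrightarrow> 0 \<le> length_mass V p c k"
  unfolding length_mass_def using return_sum_nonneg by simp

lemma summable_length_mass: "c > 0 \<Longrightarrow> summable (length_mass V p c)"
  unfolding length_mass_def using log_det_sums by (auto simp: sums_iff)

lemma summable_length_mass_if:
  assumes "c > 0"
  shows "summable (\<lambda>k. if Q k then length_mass V p c k else 0)"
  by (rule summable_comparison_test'[OF summable_length_mass[OF assms], of 0])
     (auto simp: length_mass_nonneg[OF assms])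

lemma mass_of_lengths_nonneg: "c > 0 \<Longrightarrow> 0 \<le> mass_of_lengths V p c Q"
  unfolding mass_of_lengths_def
  by (intro suminf_nonneg summable_length_mass_if) (auto simp: length_mass_nonneg)

lemma mass_of_lengths_mono:
  assumes "c > 0" "\<And>k. Q k \<Longrightarrow> R k"
  shows "mass_of_lengths V p c Q \<le> mass_of_lengths V p c R"
  unfolding mass_of_lengths_def
  using assms by (intro suminf_le summable_length_mass_if) (auto simp: length_mass_nonneg)

lemma mass_of_lengths_split:
  assumes "c > 0"
  shows "mass_of_lengths V p c Q =
    mass_of_lengths V p c (\<lambda>k. Q k \<and> R k) + mass_of_lengths V p c (\<lambda>k. Q k \<and> \<not> R k)"
  unfolding mass_of_lengths_def suminf_add[OF summable_length_mass_if[OF assms] summable_length_mass_if[OF assms]]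
  by (intro suminf_cong) auto

lemma mass_of_lengths_eq [simp]: "mass_of_lengths V p c (\<lambda>k. k = j) = length_mass V p c j"
  unfolding mass_of_lengths_def by (subst suminf_finite[of "{j}"]) auto

lemma emeasure_based_loops_length:
  assumes c: "c > 0"
  shows "emeasure (based_loop_measure V p c) {xs \<in> based_loops V. length xs = k} = ennreal (length_mass V p c k)"
proof (cases k)
  case 0
  then have empty: "{xs \<in> based_loops V. length xs = k} = {}" by (auto simp: based_loops_def)
  show ?thesis unfolding empty using 0 by (simp add: length_mass_def)
next
  case (Suc m)
  have eq: "{xs \<in> based_loops V. length xs = k} = {xs. set xs \<subseteq> V \<and> length xs = Suc m}"
    using Suc by (auto simp: based_loops_def)
  have fin': "finite {xs. set xs \<subseteq> V \<and> length xs = Suc m}"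
    using fin by (rule finite_lists_length_eq)
  have wt: "based_loop_weight p c xs = (1 / k * inverse ((1 + c) ^ k)) *
      (\<Prod>i<length xs. p (xs ! i) (xs ! (Suc i mod length xs)))" if "length xs = k" for xs
    using that by (simp add: based_loop_weight_def Let_def)
  have pos: "0 \<le> based_loop_weight p c xs" if "set xs \<subseteq> V" "length xs = k" for xs
    unfolding wt[OF that(2)] using c that Suc
    by (intro mult_nonneg_nonneg prod_nonneg ballI p_nonneg) (auto intro!: subsetD[OF that(1)] nth_mem)
  have "emeasure (based_loop_measure V p c) {xs \<in> based_loops V. length xs = k} =
      (\<Sum>xs | set xs \<subseteq> V \<and> length xs = Suc m. ennreal (based_loop_weight p c xs))"
    unfolding based_loop_measure_def eq
    by (intro emeasure_point_measure_finite2 fin') (auto simp: based_loops_def)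
  also have "\<dots> = ennreal (\<Sum>xs | set xs \<subseteq> V \<and> length xs = Suc m. based_loop_weight p c xs)"
    using pos Suc by (intro sum_ennreal) auto
  also have "(\<Sum>xs | set xs \<subseteq> V \<and> length xs = Suc m. based_loop_weight p c xs) = length_mass V p c k"
  proof -
    have "(\<Sum>xs | set xs \<subseteq> V \<and> length xs = Suc m. based_loop_weight p c xs) =
        (\<Sum>xs | set xs \<subseteq> V \<and> length xs = Suc m. (1 / k * inverse ((1 + c) ^ k)) *
          (\<Prod>i<length xs. p (xs ! i) (xs ! (Suc i mod length xs))))"
      using wt Suc by (intro sum.cong) auto
    also have "\<dots> = (1 / k * inverse ((1 + c) ^ k)) * return_sum V p (Suc m)"
      unfolding sum_distrib_left[symmetric] sum_loop_weights[OF fin] ..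
    finally show ?thesis using Suc by (simp add: length_mass_def)
  qed
  finally show ?thesis .
qed

text \<open>
  Rotations preserve the length, so loops and based loops have the same distribution of lengths.
\<close>

lemma emeasure_loop_measure:
  assumes c: "c > 0"
  shows "emeasure (loop_measure V p c) {L \<in> loops V. Q (loop_length L)} = ennreal (mass_of_lengths V p c Q)"
proof -
  let ?B = "based_loop_measure V p c"
  have sets: "sets ?B = Pow (based_loops V)" and space: "space ?B = based_loops V"
    by (auto simp: based_loop_measure_def sets_point_measure space_point_measure)
  have cls: "loop_rel V `` {xs} \<in> loops V" if "xs \<in> based_loops V" for xs
    using that by (auto simp: loops_def intro: quotientI)
  have "(\<lambda>xs. loop_rel V `` {xs}) \<in> measurable ?B (count_space (loops V))"
    using cls by (auto simp: measurable_def sets space)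
  then have "emeasure (loop_measure V p c) {L \<in> loops V. Q (loop_length L)} =
      emeasure ?B ((\<lambda>xs. loop_rel V `` {xs}) -` {L \<in> loops V. Q (loop_length L)} \<inter> space ?B)"
    unfolding loop_measure_def by (intro emeasure_distr) auto
  also have "(\<lambda>xs. loop_rel V `` {xs}) -` {L \<in> loops V. Q (loop_length L)} \<inter> space ?B =
      (\<Union>k. {xs \<in> based_loops V. length xs = k \<and> Q k})"
    using cls by (auto simp: space loop_length_class)
  also have "emeasure ?B \<dots> = (\<Sum>k. emeasure ?B {xs \<in> based_loops V. length xs = k \<and> Q k})"
    by (intro suminf_emeasure[symmetric]) (auto simp: sets disjoint_family_on_def)
  also have "\<dots> = (\<Sum>k. ennreal (if Q k then length_mass V p c k else 0))"
    using emeasure_based_loops_length[OF c] by (intro suminf_cong) auto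
  also have "\<dots> = ennreal (mass_of_lengths V p c Q)"
    unfolding mass_of_lengths_def using length_mass_nonneg[OF c]
    by (intro suminf_ennreal2 summable_length_mass_if[OF c]) auto
  finally show ?thesis .
qed

lemma total_mass_loop_measure: "c > 0 \<Longrightarrow> total_mass (loop_measure V p c) = mass_of_lengths V p c (\<lambda>_. True)"
  using emeasure_loop_measure[of c "\<lambda>_. True"] mass_of_lengths_nonneg[of c]
  by (simp add: total_mass_def measure_def)

lemma emeasure_normalized_loop_measure:
  assumes c: "c > 0"
  shows "emeasure (normalized_loop_measure V p c) {L \<in> space (normalized_loop_measure V p c). Q (loop_length L)} =
    ennreal (mass_of_lengths V p c Q / mass_of_lengths V p c (\<lambda>_. True))"
  unfolding normalized_loop_measure_def emeasure_scale_measure space_scale_measure space_loop_measure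
    emeasure_loop_measure[OF c] total_mass_loop_measure[OF c]
  using mass_of_lengths_nonneg[OF c] by (simp add: ennreal_mult[symmetric])

lemma measure_normalized_loop_measure:
  assumes c: "c > 0"
  shows "measure (normalized_loop_measure V p c) {L \<in> space (normalized_loop_measure V p c). Q (loop_length L)} =
    mass_of_lengths V p c Q / mass_of_lengths V p c (\<lambda>_. True)"
  unfolding measure_def emeasure_normalized_loop_measure[OF c]
  using mass_of_lengths_nonneg[OF c] by simp

lemma cond_prob_normalized_loop_measure:
  assumes c: "c > 0"
  shows "cond_prob (normalized_loop_measure V p c) (\<lambda>L. Q (loop_length L)) (\<lambda>L. R (loop_length L)) =
    mass_of_lengths V p c (\<lambda>k. Q k \<and> R k) / mass_of_lengths V p c R"
proof (cases "mass_of_lengths V p c (\<lambda>_. True) = 0")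
  case True
  \<comment> \<open>A vanishing total mass turns both sides into \<open>0 / 0\<close>.\<close>
  have "mass_of_lengths V p c S = 0" for S
    using mass_of_lengths_mono[OF c, of S "\<lambda>_. True"] mass_of_lengths_nonneg[OF c, of S] True by simp
  then show ?thesis
    using measure_normalized_loop_measure[OF c, of "\<lambda>k. Q k \<and> R k"] by (simp add: cond_prob_def)
next
  case False
  then show ?thesis
    using measure_normalized_loop_measure[OF c, of "\<lambda>k. Q k \<and> R k"]
      measure_normalized_loop_measure[OF c, of R] by (simp add: cond_prob_def)
qed

lemma cdf_conditional_length:
  fixes g :: "nat \<Rightarrow> real"
  assumes c: "c > 0" and pos: "mass_of_lengths V p c R > 0"
  defines "M \<equiv> normalized_loop_measure V p c"
  shows "cdf (distr (uniform_measure M {L \<in> space M. R (loop_length L)}) borel (\<lambda>L. g (loop_length L))) t =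
    mass_of_lengths V p c (\<lambda>k. R k \<and> g k \<le> t) / mass_of_lengths V p c R"
proof -
  have sets: "sets M = Pow (loops V)" and space: "space M = loops V"
    by (auto simp: M_def normalized_loop_measure_def space_scale_measure)
  let ?A = "{L \<in> space M. R (loop_length L)}"
  have tot: "mass_of_lengths V p c (\<lambda>_. True) > 0"
    using mass_of_lengths_mono[OF c, of R "\<lambda>_. True"] pos by simp
  have eA: "emeasure M ?A = ennreal (mass_of_lengths V p c R / mass_of_lengths V p c (\<lambda>_. True))"
    unfolding M_def by (rule emeasure_normalized_loop_measure[OF c])
  have meas: "(\<lambda>L. g (loop_length L)) \<in> measurable (uniform_measure M ?A) borel"
    by (auto simp: measurable_def sets space)
  have "cdf (distr (uniform_measure M ?A) borel (\<lambda>L. g (loop_length L))) t =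
      measure (uniform_measure M ?A) ((\<lambda>L. g (loop_length L)) -` {..t} \<inter> space M)"
    unfolding cdf_def by (subst measure_distr[OF meas]) auto
  also have "\<dots> = measure M (?A \<inter> ((\<lambda>L. g (loop_length L)) -` {..t} \<inter> space M)) / measure M ?A"
  proof (rule measure_uniform_measure)
    show "emeasure M ?A \<noteq> 0" "emeasure M ?A \<noteq> \<infinity>"
      unfolding eA using pos tot by auto
  qed (auto simp: sets space)
  also have "?A \<inter> ((\<lambda>L. g (loop_length L)) -` {..t} \<inter> space M) =
      {L \<in> space M. R (loop_length L) \<and> g (loop_length L) \<le> t}"
    by auto
  also have "measure M \<dots> / measure M ?A =
      mass_of_lengths V p c (\<lambda>k. R k \<and> g k \<le> t) / mass_of_lengths V p c R"
    using measure_normalized_loop_measure[OF c, of "\<lambda>k. R k \<and> g k \<le> t"]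
      measure_normalized_loop_measure[OF c, of R] tot by (simp add: M_def)
  finally show ?thesis .
qed

lemma integral_eigenvalue_distribution:
  fixes f :: "complex \<Rightarrow> real"
  assumes "f \<in> borel_measurable borel"
  shows "(\<integral>x. f x \<partial>eigenvalue_distribution V p) = (\<Sum>z\<in>#eigenvalues V p. f z) / card V"
proof -
  let ?M = "eigenvalues V p"
  have ne: "?M \<noteq> {#}" using one_in_eigenvalues by auto
  have "(\<integral>x. f x \<partial>eigenvalue_distribution V p) = measure_pmf.expectation (pmf_of_multiset ?M) f"
    unfolding eigenvalue_distribution_def eigenvalues_def[symmetric]
    using assms by (subst integral_distr) auto
  also have "\<dots> = (\<Sum>z\<in>set_mset ?M. pmf (pmf_of_multiset ?M) z *\<^sub>R f z)"
    using ne by (intro integral_measure_pmf) auto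
  also have "\<dots> = (\<Sum>z\<in>set_mset ?M. count ?M z * f z) / card V"
    using ne by (simp add: size_eigenvalues sum_divide_distrib)
  also have "(\<Sum>z\<in>set_mset ?M. count ?M z * f z) = (\<Sum>z\<in>#?M. f z)"
    by (rule sum_count_eq_sum_mset) auto
  finally show ?thesis .
qed

end

section \<open>Uniform integrability of the logarithm\<close>

text \<open>
  All spectra lie in the closed unit disk. Composition with the nearest-point projection onto the disk
  turns a function that is continuous there into a bounded continuous function on the plane, against
  which weak convergence can be tested.
\<close>

abbreviation disk_proj :: "complex \<Rightarrow> complex" where
  "disk_proj \<equiv> closest_point (cball 0 1)"

lemma disk_proj_norm: "cmod (disk_proj x) \<le> 1"
  using closest_point_in_set[of "cball (0 :: complex) 1" x] by simp

lemma disk_proj_self: "cmod x \<le> 1 \<Longrightarrow> disk_proj x = x"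
  by (simp add: closest_point_self)

lemma continuous_disk_proj: "continuous_on A disk_proj"
  by (intro continuous_on_closest_point) auto

lemma disk_proj_measurable [measurable]: "disk_proj \<in> borel_measurable borel"
  by (intro borel_measurable_continuous_onI continuous_disk_proj)

lemma Re_le_1_of_disk: "cmod x \<le> 1 \<Longrightarrow> Re x \<le> 1"
  using complex_Re_le_cmod[of x] by linarith

lemma Re_less_1_of_disk:
  assumes "cmod x \<le> 1" "x \<noteq> 1"
  shows "Re x < 1"
proof (rule ccontr)
  assume "\<not> Re x < 1"
  then have Re: "Re x = 1" using Re_le_1_of_disk[OF assms(1)] by simp
  have "(Re x)\<^sup>2 + (Im x)\<^sup>2 \<le> 1"
    using assms(1) by (metis cmod_power2 norm_ge_zero power_le_one)
  then have "Im x = 0" using Re by simp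
  then show False using assms(2) Re by (simp add: complex_eq_iff)
qed

text \<open>
  The shift by \<open>\<delta> > 0\<close> moves the singularity of \<open>- ln \<bar>1 - x\<bar>\<close> off the unit disk.
\<close>

definition log_potential :: "real \<Rightarrow> complex \<Rightarrow> real" where
  "log_potential \<delta> x = - ln (cmod (complex_of_real \<delta> + (1 - x)))"

lemma cmod_shift_mono:
  assumes "cmod x \<le> 1" "0 \<le> \<delta>" "\<delta> \<le> \<epsilon>"
  shows "cmod (complex_of_real \<delta> + (1 - x)) \<le> cmod (complex_of_real \<epsilon> + (1 - x))"
proof -
  have "(\<delta> + (1 - Re x))\<^sup>2 \<le> (\<epsilon> + (1 - Re x))\<^sup>2"
    using assms Re_le_1_of_disk[OF assms(1)] by (intro power_mono) auto
  then show ?thesis unfolding cmod_def by simp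
qed

lemma cmod_shift_ge: "cmod x \<le> 1 \<Longrightarrow> \<delta> \<le> cmod (complex_of_real \<delta> + (1 - x))"
  using complex_Re_le_cmod[of "complex_of_real \<delta> + (1 - x)"] Re_le_1_of_disk[of x] by simp

lemma cmod_shift_le: "cmod x \<le> 1 \<Longrightarrow> 0 \<le> \<delta> \<Longrightarrow> cmod (complex_of_real \<delta> + (1 - x)) \<le> \<delta> + 2"
  using norm_triangle_ineq[of "complex_of_real \<delta>" "1 - x"] norm_triangle_ineq4[of 1 x] by simp

lemma log_potential_antimono:
  assumes "cmod x \<le> 1" "0 \<le> \<delta>" "\<delta> \<le> \<epsilon>" "0 < \<delta> \<or> x \<noteq> 1"
  shows "log_potential \<epsilon> x \<le> log_potential \<delta> x"
proof -
  have "0 < cmod (complex_of_real \<delta> + (1 - x))"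
    using assms cmod_shift_ge[OF assms(1), of \<delta>] by (cases "\<delta> = 0") auto
  moreover note cmod_shift_mono[OF assms(1-3)]
  ultimately have "ln (cmod (complex_of_real \<delta> + (1 - x))) \<le> ln (cmod (complex_of_real \<epsilon> + (1 - x)))"
    by (subst ln_le_cancel_iff) linarith+
  then show ?thesis by (simp add: log_potential_def)
qed

lemma ln3_le_2: "ln (3 :: real) \<le> 2"
  using ln_le_minus_one[of "3 :: real"] by simp

lemma log_potential_ge:
  assumes "cmod x \<le> 1" "0 \<le> \<delta>" "\<delta> \<le> 1"
  shows "- ln 3 \<le> log_potential \<delta> x"
proof (cases "complex_of_real \<delta> + (1 - x) = 0")
  case False
  then show ?thesis
    using cmod_shift_le[OF assms(1,2)] assms(3) by (simp add: log_potential_def)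
qed (simp add: log_potential_def)

lemma continuous_log_potential:
  assumes "\<delta> > 0"
  shows "continuous_on (cball 0 1) (log_potential \<delta>)"
  unfolding log_potential_def
proof (intro continuous_intros ballI)
  fix x :: complex assume "x \<in> cball 0 1"
  then show "cmod (complex_of_real \<delta> + (1 - x)) \<noteq> 0"
    using cmod_shift_ge[of x \<delta>] assms by auto
qed

lemma log_potential_measurable [measurable]: "log_potential \<delta> \<in> borel_measurable borel"
  unfolding log_potential_def by measurable

lemma log_potential_tendsto:
  assumes "x \<noteq> 1" "\<delta>s \<longlonglongrightarrow> 0"
  shows "(\<lambda>m. log_potential (\<delta>s m) x) \<longlonglongrightarrow> log_potential 0 x"
proof -
  have lim: "(\<lambda>m. complex_of_real (\<delta>s m) + (1 - x)) \<longlonglongrightarrow> complex_of_real 0 + (1 - x)"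
    by (intro tendsto_intros assms)
  show ?thesis
    unfolding log_potential_def
    by (intro tendsto_minus tendsto_ln tendsto_norm lim) (use assms(1) in auto)
qed

text \<open>
  On the disk \<open>1 - x\<close> has modulus at most \<open>2\<close> and argument at most \<open>pi / 2\<close>, so the logarithm exceeds
  \<open>- ln \<bar>1 - x\<bar>\<close> in modulus by at most \<open>pi / 2 + 2 * ln 2\<close>. This number is just below \<open>3\<close>.
\<close>

lemma norm_Ln_le:
  assumes x: "cmod x \<le> 1" "x \<noteq> 1"
  shows "cmod (Ln (1 - x)) \<le> 3 + log_potential 0 x"
proof -
  let ?l = "ln (cmod (1 - x))"
  have ne: "1 - x \<noteq> 0" using x by auto
  have "cmod (1 - x) \<le> 2" using cmod_shift_le[OF x(1), of 0] by simp
  then have "?l \<le> ln 2" using ne by (subst ln_le_cancel_iff) auto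
  then have "\<bar>?l\<bar> \<le> 2 * ln 2 - ?l" by (cases "?l \<ge> 0") auto
  moreover have "cmod (Ln (1 - x)) \<le> \<bar>?l\<bar> + \<bar>Im (Ln (1 - x))\<bar>"
    using cmod_le[of "Ln (1 - x)"] ne by simp
  moreover have "\<bar>Im (Ln (1 - x))\<bar> \<le> pi / 2"
    using Re_Ln_pos_le[OF ne] Re_le_1_of_disk[OF x(1)] by simp
  ultimately show ?thesis
    using pi_approx ln2_le_25_over_36 by (simp add: log_potential_def)
qed

lemma continuous_on_disk_proj_comp:
  fixes f :: "complex \<Rightarrow> real"
  assumes "continuous_on (cball 0 1) f"
  shows "continuous_on UNIV (\<lambda>x. f (disk_proj x))" "bounded (range (\<lambda>x. f (disk_proj x)))"
proof -
  show "continuous_on UNIV (\<lambda>x. f (disk_proj x))"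
    by (rule continuous_on_compose2[OF assms continuous_disk_proj]) (auto simp: disk_proj_norm)
  have "bounded (f ` cball 0 1)"
    by (intro compact_imp_bounded compact_continuous_image assms) auto
  then show "bounded (range (\<lambda>x. f (disk_proj x)))"
    by (rule bounded_subset) (auto simp: disk_proj_norm)
qed

lemma sum_mset_neg: "(\<Sum>z\<in>#M. - f z) = - (\<Sum>z\<in>#M. f z :: real)"
  by (induction M) auto

lemma one_minus_not_nonpos_Reals: "cmod x \<le> 1 \<Longrightarrow> x \<noteq> 1 \<Longrightarrow> 1 - x \<notin> \<real>\<^sub>\<le>\<^sub>0"
  using Re_less_1_of_disk[of x] by (auto simp: complex_nonpos_Reals_iff)

lemma continuous_power_parts:
  "continuous_on A (\<lambda>x :: complex. Re (x ^ j))" "continuous_on A (\<lambda>x :: complex. Im (x ^ j))"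
  by (intro continuous_intros)+

locale chain_sequence =
  fixes V :: "nat \<Rightarrow> 'a set" and p :: "nat \<Rightarrow> 'a \<Rightarrow> 'a \<Rightarrow> real" and \<pi> :: "nat \<Rightarrow> 'a \<Rightarrow> real"
    and c\<^sub>1 c\<^sub>2 :: real and \<nu> :: "complex measure"
  assumes chain: "n \<ge> 1 \<Longrightarrow> elliptic_chain (V n) (p n) (\<pi> n) c\<^sub>1 c\<^sub>2"
    and nu_prob: "prob_space \<nu>" and nu_borel: "sets \<nu> = sets borel"
    and nu_lim: "weakly_converges (\<lambda>n. eigenvalue_distribution (V n) (p n)) \<nu>"
    and card_lim: "filterlim (\<lambda>n. real (card (V n))) at_top sequentially"
begin

sublocale prob_space \<nu> by (rule nu_prob)

abbreviation "N n \<equiv> real (card (V n))"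

lemma fin_chain: "n \<ge> 1 \<Longrightarrow> finite_chain (V n) (p n) (\<pi> n)"
  using chain elliptic_chain.axioms(1) by blast

lemma N_pos: "n \<ge> 1 \<Longrightarrow> N n > 0"
  using finite_chain.card_pos[OF fin_chain] by simp

lemma c_pos: "c\<^sub>1 > 0" "c\<^sub>2 > 0"
  using chain[of 1] by (simp_all add: elliptic_chain.c1_pos elliptic_chain.c2_pos)

text \<open>
  The constant of the resolvent bound, common to all chains of the sequence.
\<close>

definition C :: real where "C = sqrt 2 / (c\<^sub>1 * c\<^sub>2)"

lemma C_pos: "C > 0" unfolding C_def using c_pos by simp

declare nu_borel [measurable_cong]

lemma eventually_ge_1: "eventually (\<lambda>n. n \<ge> (1::nat)) sequentially"
  by (rule eventually_ge_at_top)

lemma spectral_average_tendsto_bounded: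
  fixes f :: "complex \<Rightarrow> real"
  assumes "continuous_on UNIV f" "bounded (range f)"
  shows "(\<lambda>n. (\<Sum>z\<in>#eigenvalues (V n) (p n). f z) / N n) \<longlonglongrightarrow> (\<integral>x. f x \<partial>\<nu>)"
proof -
  have "(\<lambda>n. \<integral>x. f x \<partial>eigenvalue_distribution (V n) (p n)) \<longlonglongrightarrow> (\<integral>x. f x \<partial>\<nu>)"
    using nu_lim assms unfolding weakly_converges_def by blast
  moreover have "\<forall>\<^sub>F n in sequentially. (\<integral>x. f x \<partial>eigenvalue_distribution (V n) (p n)) =
      (\<Sum>z\<in>#eigenvalues (V n) (p n). f z) / N n"
    using eventually_ge_1
  proof eventually_elim
    case (elim n)
    then interpret finite_chain "V n" "p n" "\<pi> n" by (rule fin_chain)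
    show ?case
      using assms(1) by (intro integral_eigenvalue_distribution borel_measurable_continuous_onI)
  qed
  ultimately show ?thesis by (rule Lim_transform_eventually)
qed

lemma spectral_average_tendsto:
  fixes f :: "complex \<Rightarrow> real"
  assumes "continuous_on (cball 0 1) f"
  shows "(\<lambda>n. (\<Sum>z\<in>#eigenvalues (V n) (p n). f z) / N n) \<longlonglongrightarrow> (\<integral>x. f (disk_proj x) \<partial>\<nu>)"
proof (rule Lim_transform_eventually[OF spectral_average_tendsto_bounded[OF continuous_on_disk_proj_comp[OF assms]]])
  show "\<forall>\<^sub>F n in sequentially. (\<Sum>z\<in>#eigenvalues (V n) (p n). f (disk_proj z)) / N n =
      (\<Sum>z\<in>#eigenvalues (V n) (p n). f z) / N n"
    using eventually_ge_1
  proof eventually_elim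
    case (elim n)
    then interpret finite_chain "V n" "p n" "\<pi> n" by (rule fin_chain)
    have "image_mset (\<lambda>z. f (disk_proj z)) (eigenvalues (V n) (p n)) = image_mset f (eigenvalues (V n) (p n))"
      by (intro image_mset_cong) (simp add: disk_proj_self norm_eigenvalue_le_1)
    then show ?case by simp
  qed
qed

lemma integrable_disk_proj:
  fixes f :: "complex \<Rightarrow> real"
  assumes "continuous_on (cball 0 1) f"
  shows "integrable \<nu> (\<lambda>x. f (disk_proj x))"
proof -
  obtain B where "\<And>x. norm (f (disk_proj x)) \<le> B"
    using continuous_on_disk_proj_comp(2)[OF assms] unfolding bounded_iff by auto
  moreover have "(\<lambda>x. f (disk_proj x)) \<in> borel_measurable \<nu>"
    using borel_measurable_continuous_onI[OF continuous_on_disk_proj_comp(1)[OF assms]]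
    by (simp add: measurable_cong_sets[OF nu_borel refl])
  ultimately show ?thesis by (intro integrable_const_bound[of _ B]) auto
qed

text \<open>
  Test the weak convergence with a function that vanishes exactly on the disk.
\<close>

lemma AE_disk: "AE x in \<nu>. cmod x \<le> 1"
proof -
  let ?f = "\<lambda>x :: complex. min 1 (max 0 (cmod x - 1))"
  have cont: "continuous_on UNIV ?f" by (intro continuous_intros)
  have bdd: "bounded (range ?f)"
    unfolding bounded_iff by (rule exI[of _ 1]) auto
  have "(\<lambda>n. (\<Sum>z\<in>#eigenvalues (V n) (p n). ?f z) / N n) \<longlonglongrightarrow> 0"
  proof (rule Lim_transform_eventually[OF tendsto_const])
    show "\<forall>\<^sub>F n in sequentially. 0 = (\<Sum>z\<in>#eigenvalues (V n) (p n). ?f z) / N n"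
      using eventually_ge_1
    proof eventually_elim
      case (elim n)
      then interpret finite_chain "V n" "p n" "\<pi> n" by (rule fin_chain)
      have "image_mset ?f (eigenvalues (V n) (p n)) = image_mset (\<lambda>_. 0) (eigenvalues (V n) (p n))"
        using norm_eigenvalue_le_1 by (intro image_mset_cong) auto
      then show ?case by simp
    qed
  qed
  then have int: "(\<integral>x. ?f x \<partial>\<nu>) = 0"
    using LIMSEQ_unique[OF spectral_average_tendsto_bounded[OF cont bdd]] by simp
  have "integrable \<nu> ?f"
    using borel_measurable_continuous_onI[OF cont]
    by (intro integrable_const_bound[of _ 1]) (auto simp: measurable_cong_sets[OF nu_borel refl])
  then have "AE x in \<nu>. ?f x = 0"
    using int by (subst (asm) integral_nonneg_eq_0_iff_AE) auto
  then show ?thesis by eventually_elim (auto simp: min_def max_def split: if_splits)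
qed

definition other_average :: "nat \<Rightarrow> real \<Rightarrow> real" where
  "other_average n \<delta> = (\<Sum>z\<in>#other_eigenvalues (V n) (p n). log_potential \<delta> z) / N n"

text \<open>
  The potential of the limit distribution. The value at \<open>0\<close> is the integral of \<open>- ln \<bar>1 - x\<bar>\<close>.
\<close>

definition J :: "real \<Rightarrow> real" where
  "J \<delta> = (\<integral>x. log_potential \<delta> (disk_proj x) \<partial>\<nu>)"

lemma other_average_bound:
  assumes "n \<ge> 1" "0 < \<delta>" "\<delta> \<le> \<epsilon>"
  shows "other_average n \<delta> \<le> other_average n \<epsilon> + 2 * C * sqrt \<epsilon>"
proof -
  interpret elliptic_chain "V n" "p n" "\<pi> n" c\<^sub>1 c\<^sub>2 using assms by (intro chain)
  have "(\<Sum>z\<in>#other_eigenvalues (V n) (p n). log_potential \<delta> z) -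
      (\<Sum>z\<in>#other_eigenvalues (V n) (p n). log_potential \<epsilon> z) \<le> 2 * C * N n * (sqrt \<epsilon> - sqrt \<delta>)"
    unfolding log_potential_def sum_mset_neg C_def using log_truncation_bound[OF assms(2,3)] by linarith
  also have "\<dots> \<le> 2 * C * N n * sqrt \<epsilon>"
    using C_pos N_pos[OF assms(1)] assms(2) by (intro mult_left_mono) auto
  finally have "(\<Sum>z\<in>#other_eigenvalues (V n) (p n). log_potential \<delta> z) \<le>
      (\<Sum>z\<in>#other_eigenvalues (V n) (p n). log_potential \<epsilon> z) + 2 * C * sqrt \<epsilon> * N n"
    by (simp add: mult_ac)
  from divide_right_mono[OF this, of "N n"] show ?thesis
    using N_pos[OF assms(1)] by (simp add: other_average_def add_divide_distrib)
qed

lemma other_average_antimono: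
  assumes "n \<ge> 1" "0 < \<delta>" "\<delta> \<le> \<epsilon>"
  shows "other_average n \<epsilon> \<le> other_average n \<delta>"
proof -
  interpret elliptic_chain "V n" "p n" "\<pi> n" c\<^sub>1 c\<^sub>2 using assms by (intro chain)
  have "(\<Sum>z\<in>#other_eigenvalues (V n) (p n). log_potential \<epsilon> z) \<le>
      (\<Sum>z\<in>#other_eigenvalues (V n) (p n). log_potential \<delta> z)"
    using other_eigenvalue_norm_le_1 assms by (intro sum_mset_mono log_potential_antimono) auto
  then show ?thesis unfolding other_average_def by (intro divide_right_mono) auto
qed

lemma other_average_1_nonpos:
  assumes "n \<ge> 1"
  shows "other_average n 1 \<le> 0"
proof -
  interpret elliptic_chain "V n" "p n" "\<pi> n" c\<^sub>1 c\<^sub>2 using assms by (intro chain)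
  have "log_potential 1 z \<le> 0" if "cmod z \<le> 1" for z
    using cmod_shift_ge[OF that, of 1] by (simp add: log_potential_def)
  then have "(\<Sum>z\<in>#other_eigenvalues (V n) (p n). log_potential 1 z) \<le> (\<Sum>z\<in>#other_eigenvalues (V n) (p n). 0)"
    using other_eigenvalue_norm_le_1 by (intro sum_mset_mono) auto
  then show ?thesis unfolding other_average_def using N_pos[OF assms] by (simp add: divide_le_0_iff)
qed

lemma over_N_tendsto_0: "(\<lambda>n. b / N n) \<longlonglongrightarrow> 0"
  using card_lim by (intro tendsto_divide_0[OF tendsto_const] filterlim_at_top_imp_at_infinity)

text \<open>
  For a fixed shift the single term of the eigenvalue \<open>1\<close> is negligible against the number of states.
\<close>

lemma other_average_tendsto:
  assumes "\<delta> > 0"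
  shows "(\<lambda>n. other_average n \<delta>) \<longlonglongrightarrow> J \<delta>"
proof -
  have "(\<lambda>n. (\<Sum>z\<in>#eigenvalues (V n) (p n). log_potential \<delta> z) / N n - log_potential \<delta> 1 / N n) \<longlonglongrightarrow> J \<delta> - 0"
    unfolding J_def by (intro tendsto_diff spectral_average_tendsto over_N_tendsto_0 continuous_log_potential assms)
  then have "(\<lambda>n. (\<Sum>z\<in>#eigenvalues (V n) (p n). log_potential \<delta> z) / N n - log_potential \<delta> 1 / N n) \<longlonglongrightarrow> J \<delta>"
    by simp
  then show ?thesis
  proof (rule Lim_transform_eventually)
    show "\<forall>\<^sub>F n in sequentially. (\<Sum>z\<in>#eigenvalues (V n) (p n). log_potential \<delta> z) / N n - log_potential \<delta> 1 / N n = other_average n \<delta>"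
      using eventually_ge_1
    proof eventually_elim
      case (elim n)
      then interpret finite_chain "V n" "p n" "\<pi> n" by (rule fin_chain)
      show ?case by (simp add: other_average_def sum_eigenvalues_split add_divide_distrib)
    qed
  qed
qed

lemma J_bound:
  assumes "0 < \<delta>" "\<delta> \<le> \<epsilon>"
  shows "J \<delta> \<le> J \<epsilon> + 2 * C * sqrt \<epsilon>"
proof (rule tendsto_le[OF _ _ other_average_tendsto[OF assms(1)]])
  show "(\<lambda>n. other_average n \<epsilon> + 2 * C * sqrt \<epsilon>) \<longlonglongrightarrow> J \<epsilon> + 2 * C * sqrt \<epsilon>"
    using assms by (intro tendsto_intros other_average_tendsto) auto
  show "\<forall>\<^sub>F n in sequentially. other_average n \<delta> \<le> other_average n \<epsilon> + 2 * C * sqrt \<epsilon>"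
    using eventually_ge_1 by eventually_elim (intro other_average_bound assms)
qed simp

lemma J_antimono:
  assumes "0 < \<delta>" "\<delta> \<le> \<epsilon>"
  shows "J \<epsilon> \<le> J \<delta>"
proof (rule tendsto_le[OF _ other_average_tendsto[OF assms(1)]])
  show "(\<lambda>n. other_average n \<epsilon>) \<longlonglongrightarrow> J \<epsilon>"
    using assms by (intro other_average_tendsto) auto
  show "\<forall>\<^sub>F n in sequentially. other_average n \<epsilon> \<le> other_average n \<delta>"
    using eventually_ge_1 by eventually_elim (intro other_average_antimono assms)
qed simp

text \<open>
  The potential is nonpositive for the shift \<open>1\<close>, since \<open>\<bar>2 - x\<bar> \<ge> 1\<close> on the disk.
\<close>

lemma J_le: "0 < \<delta> \<Longrightarrow> \<delta> \<le> 1 \<Longrightarrow> J \<delta> \<le> 2 * C"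
proof -
  assume \<delta>: "0 < \<delta>" "\<delta> \<le> 1"
  have "\<forall>\<^sub>F n in sequentially. other_average n 1 \<le> 0"
    using eventually_ge_1 by eventually_elim (rule other_average_1_nonpos)
  then have "J 1 \<le> 0"
    by (intro tendsto_upperbound[OF other_average_tendsto]) auto
  then show ?thesis using J_bound[OF \<delta>] by simp
qed

text \<open>
  The pointwise limit of \<open>3 + log_potential \<delta>\<close> as \<open>\<delta>\<close> tends to \<open>0\<close>. The constant \<open>3\<close> makes all
  these functions nonnegative on the disk for \<open>\<delta> \<le> 1\<close> and lets the limit dominate the modulus of the logarithm;
  the infinite value makes integrability exclude an atom at \<open>1\<close>.
\<close>

definition sing_bound :: "complex \<Rightarrow> ennreal" where
  "sing_bound x = (if disk_proj x = 1 then \<infinity> else ennreal (3 + log_potential 0 (disk_proj x)))"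

text \<open>
  Fatou's lemma applied to the bounds on \<open>J \<delta>\<close> as \<open>\<delta>\<close> tends to \<open>0\<close>.
\<close>

lemma nn_integral_sing_bound: "(\<integral>\<^sup>+x. sing_bound x \<partial>\<nu>) \<le> ennreal (3 + 2 * C)"
proof -
  let ?d = "\<lambda>m :: nat. inverse (real (Suc m))"
  let ?H = "\<lambda>m x. ennreal (3 + log_potential (?d m) (disk_proj x))"
  have d: "0 < ?d m" "?d m \<le> 1" for m by (auto simp: field_simps)
  have lim: "(\<lambda>m. ?H m x) \<longlonglongrightarrow> sing_bound x" for x
  proof (cases "disk_proj x = 1")
    case True
    have "log_potential (?d m) 1 = ln (real (Suc m))" for m
      by (simp add: log_potential_def norm_inverse ln_inverse del: of_nat_Suc)
    then have "?H m x = ennreal (3 + ln (real (Suc m)))" for m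
      using True by (simp only:)
    moreover have "filterlim (\<lambda>m. 3 + ln (real (Suc m))) at_top sequentially"
      by (intro filterlim_tendsto_add_at_top[OF tendsto_const] filterlim_compose[OF ln_at_top]
          filterlim_compose[OF filterlim_real_sequentially filterlim_Suc])
    ultimately show ?thesis
      using True by (simp only: sing_bound_def ennreal_tendsto_top_eq_at_top infinity_ennreal_def if_True simp_thms)
  next
    case False
    then show ?thesis
      unfolding sing_bound_def using log_potential_tendsto[OF False LIMSEQ_inverse_real_of_nat]
      by (auto intro!: tendsto_ennrealI tendsto_add simp del: of_nat_Suc)
  qed
  have int: "(\<integral>\<^sup>+x. ?H m x \<partial>\<nu>) \<le> ennreal (3 + 2 * C)" for m
  proof -
    have i: "integrable \<nu> (\<lambda>x. log_potential (?d m) (disk_proj x))"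
      by (intro integrable_disk_proj continuous_log_potential d)
    have "(\<integral>\<^sup>+x. ?H m x \<partial>\<nu>) = ennreal (\<integral>x. 3 + log_potential (?d m) (disk_proj x) \<partial>\<nu>)"
    proof (rule nn_integral_eq_integral)
      show "AE x in \<nu>. 0 \<le> 3 + log_potential (?d m) (disk_proj x)"
        using log_potential_ge[OF disk_proj_norm, of "?d m"] d[of m] ln3_le_2
        by (intro AE_I2) (smt (verit))
    qed (use i in auto)
    also have "(\<integral>x. 3 + log_potential (?d m) (disk_proj x) \<partial>\<nu>) = 3 + J (?d m)"
      using i prob_space by (simp add: J_def)
    also have "ennreal (3 + J (?d m)) \<le> ennreal (3 + 2 * C)"
      using J_le[OF d] by (intro ennreal_leI) simp
    finally show ?thesis .
  qed
  have "(\<integral>\<^sup>+x. sing_bound x \<partial>\<nu>) = (\<integral>\<^sup>+x. liminf (\<lambda>m. ?H m x) \<partial>\<nu>)"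
    using lim_imp_Liminf[OF _ lim] by simp
  also have "\<dots> \<le> liminf (\<lambda>m. \<integral>\<^sup>+x. ?H m x \<partial>\<nu>)"
    by (intro nn_integral_liminf) measurable
  also have "\<dots> \<le> ennreal (3 + 2 * C)"
    using int by (intro Liminf_le) auto
  finally show ?thesis .
qed

lemma sing_bound_measurable [measurable]: "sing_bound \<in> borel_measurable \<nu>"
  unfolding sing_bound_def by measurable

lemma nn_integral_abs_log:
  "(\<integral>\<^sup>+x\<in>cball 0 1. abs_log_one_minus x \<partial>\<nu>) \<le> ennreal (3 + 8 * sqrt 2 * inverse c\<^sub>1 * inverse (c\<^sub>2 ^ 4))"
proof -
  have "(\<integral>\<^sup>+x\<in>cball 0 1. abs_log_one_minus x \<partial>\<nu>) \<le> (\<integral>\<^sup>+x. sing_bound x \<partial>\<nu>)"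
  proof (intro nn_integral_mono)
    fix x
    show "abs_log_one_minus x * indicator (cball 0 1) x \<le> sing_bound x"
      using norm_Ln_le[of x]
      by (auto simp: indicator_def abs_log_one_minus_def sing_bound_def disk_proj_self intro: ennreal_leI)
  qed
  also have "\<dots> \<le> ennreal (3 + 2 * C)" by (rule nn_integral_sing_bound)
  also have "\<dots> \<le> ennreal (3 + 8 * sqrt 2 * inverse c\<^sub>1 * inverse (c\<^sub>2 ^ 4))"
  proof -
    interpret elliptic_chain "V 1" "p 1" "\<pi> 1" c\<^sub>1 c\<^sub>2 by (intro chain) simp
    \<comment> \<open>Since \<open>c\<^sub>2 \<le> 1\<close>, the constant \<open>2 * C = 2 * sqrt 2 / (c\<^sub>1 * c\<^sub>2)\<close> is well below that of the final bound.\<close>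
    have "c\<^sub>2 ^ 4 \<le> c\<^sub>2 ^ 1" using c2_le_1 c_pos by (intro power_decreasing) auto
    then have "inverse c\<^sub>2 \<le> inverse (c\<^sub>2 ^ 4)"
      using c_pos by (intro le_imp_inverse_le) auto
    then have "2 * sqrt 2 * inverse c\<^sub>1 * inverse c\<^sub>2 \<le> 8 * sqrt 2 * inverse c\<^sub>1 * inverse (c\<^sub>2 ^ 4)"
      using c_pos by (intro mult_mono) auto
    then show ?thesis unfolding C_def by (intro ennreal_leI) (simp add: divide_inverse mult_ac)
  qed
  finally show ?thesis .
qed

lemma AE_disk_proj_ne_1: "AE x in \<nu>. disk_proj x \<noteq> 1"
proof -
  have "(\<integral>\<^sup>+x. sing_bound x \<partial>\<nu>) \<noteq> \<infinity>"
    using nn_integral_sing_bound by (auto simp: top_unique)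
  then have "AE x in \<nu>. sing_bound x \<noteq> \<infinity>"
    by (intro nn_integral_noteq_infinite) measurable
  then show ?thesis by eventually_elim (auto simp: sing_bound_def)
qed

lemma integrable_log_potential_0: "integrable \<nu> (\<lambda>x. log_potential 0 (disk_proj x))"
proof -
  have "integrable \<nu> (\<lambda>x. 3 + log_potential 0 (disk_proj x))"
  proof (rule integrableI_bounded)
    have "AE x in \<nu>. ennreal (norm (3 + log_potential 0 (disk_proj x))) = sing_bound x"
      using AE_disk_proj_ne_1
    proof eventually_elim
      case (elim x)
      have "0 \<le> 3 + log_potential 0 (disk_proj x)"
        using log_potential_ge[OF disk_proj_norm[of x], of 0] ln3_le_2 by simp
      then show ?case using elim by (simp add: sing_bound_def)
    qed
    then have "(\<integral>\<^sup>+x. ennreal (norm (3 + log_potential 0 (disk_proj x))) \<partial>\<nu>) = (\<integral>\<^sup>+x. sing_bound x \<partial>\<nu>)"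
      by (rule nn_integral_cong_AE)
    then show "(\<integral>\<^sup>+x. ennreal (norm (3 + log_potential 0 (disk_proj x))) \<partial>\<nu>) < \<infinity>"
      using nn_integral_sing_bound by (auto simp: top_unique less_top[symmetric])
  qed measurable
  from Bochner_Integration.integrable_diff[OF this integrable_const[of 3]]
  show ?thesis by simp
qed

lemma J_tendsto: "(\<lambda>m. J (inverse (real (Suc m)))) \<longlonglongrightarrow> J 0"
  unfolding J_def
proof (rule integral_dominated_convergence)
  let ?d = "\<lambda>m :: nat. inverse (real (Suc m))"
  show "integrable \<nu> (\<lambda>x. \<bar>log_potential 0 (disk_proj x)\<bar> + 2)"
    using integrable_log_potential_0 by simp
  show "AE x in \<nu>. (\<lambda>m. log_potential (?d m) (disk_proj x)) \<longlonglongrightarrow> log_potential 0 (disk_proj x)"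
    using AE_disk_proj_ne_1 by eventually_elim (intro log_potential_tendsto LIMSEQ_inverse_real_of_nat)
  show "AE x in \<nu>. norm (log_potential (?d m) (disk_proj x)) \<le> \<bar>log_potential 0 (disk_proj x)\<bar> + 2" for m
    using AE_disk_proj_ne_1
  proof eventually_elim
    case (elim x)
    have "log_potential (?d m) (disk_proj x) \<le> log_potential 0 (disk_proj x)"
      using elim by (intro log_potential_antimono disk_proj_norm) auto
    moreover have "- ln 3 \<le> log_potential (?d m) (disk_proj x)"
      by (intro log_potential_ge disk_proj_norm) (auto simp: field_simps)
    ultimately show ?case using ln3_le_2 by (simp del: of_nat_Suc)
  qed
qed measurable

lemma J_0_bounds:
  assumes "0 < \<epsilon>"
  shows "J \<epsilon> \<le> J 0" "J 0 \<le> J \<epsilon> + 2 * C * sqrt \<epsilon>"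
proof -
  have ev: "\<forall>\<^sub>F m in sequentially. inverse (real (Suc m)) < \<epsilon>"
    using order_tendstoD(2)[OF LIMSEQ_inverse_real_of_nat assms] .
  show "J \<epsilon> \<le> J 0"
    by (rule tendsto_lowerbound[OF J_tendsto])
       (use ev in \<open>auto elim!: eventually_mono intro!: J_antimono\<close>)
  show "J 0 \<le> J \<epsilon> + 2 * C * sqrt \<epsilon>"
    by (rule tendsto_upperbound[OF J_tendsto])
       (use ev in \<open>auto elim!: eventually_mono intro!: J_bound\<close>)
qed

text \<open>
  The cut-off error is uniform in \<open>n\<close>, so the shift may tend to \<open>0\<close> together with \<open>n\<close>, at any rate.
\<close>

lemma other_average_diagonal:
  assumes pos: "\<forall>\<^sub>F n in sequentially. 0 < \<delta> n" and lim: "\<delta> \<longlonglongrightarrow> 0"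
  shows "(\<lambda>n. other_average n (\<delta> n)) \<longlonglongrightarrow> J 0"
proof (rule tendstoI)
  fix \<eta> :: real assume "\<eta> > 0"
  \<comment> \<open>The level at which the cut-off error \<open>2 * C * sqrt \<epsilon>\<close> equals \<open>\<eta> / 3\<close>.\<close>
  define \<epsilon> where "\<epsilon> = (\<eta> / (6 * C))\<^sup>2"
  have \<epsilon>: "\<epsilon> > 0" "2 * C * sqrt \<epsilon> = \<eta> / 3"
    using \<open>\<eta> > 0\<close> C_pos by (auto simp: \<epsilon>_def)
  have "\<forall>\<^sub>F n in sequentially. \<bar>other_average n \<epsilon> - J \<epsilon>\<bar> < \<eta> / 3"
    using tendstoD[OF other_average_tendsto[OF \<epsilon>(1)], of "\<eta> / 3"] \<open>\<eta> > 0\<close> by (simp add: dist_real_def)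
  moreover have "\<forall>\<^sub>F n in sequentially. \<delta> n < \<epsilon>"
    using order_tendstoD(2)[OF lim \<epsilon>(1)] .
  ultimately show "\<forall>\<^sub>F n in sequentially. dist (other_average n (\<delta> n)) (J 0) < \<eta>"
    using pos eventually_ge_1
  proof eventually_elim
    case (elim n)
    have "other_average n (\<delta> n) \<le> other_average n \<epsilon> + \<eta> / 3"
      using other_average_bound[of n "\<delta> n" \<epsilon>] elim \<epsilon>(2) by simp
    moreover have "other_average n \<epsilon> \<le> other_average n (\<delta> n)"
      using other_average_antimono[of n "\<delta> n" \<epsilon>] elim by simp
    ultimately show ?case
      using J_0_bounds[OF \<epsilon>(1)] elim(1) unfolding \<epsilon>(2) dist_real_def by linarith
  qed
qed

text \<open>
  In the logarithm of the determinant the eigenvalue \<open>1\<close> contributes \<open>- ln (c n)\<close>, hence \<open>b\<close> per state,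
  and the other eigenvalues contribute the logarithmic integral of the limit. Below, this is
  also applied to auxiliary killing rates that play the part of a cut-off in the length.
\<close>

lemma total_mass_tendsto:
  assumes pos: "\<forall>\<^sub>F n in sequentially. 0 < c n" and lim: "c \<longlonglongrightarrow> 0"
    and log: "(\<lambda>n. - ln (c n) / N n) \<longlonglongrightarrow> b"
  shows "(\<lambda>n. mass_of_lengths (V n) (p n) (c n) (\<lambda>_. True) / N n) \<longlonglongrightarrow> b + J 0"
proof -
  have "(\<lambda>n. ln (1 + c n) + - ln (c n) / N n + other_average n (c n)) \<longlonglongrightarrow> ln (1 + 0) + b + J 0"
    by (intro tendsto_intros lim log other_average_diagonal pos) auto
  then have "(\<lambda>n. ln (1 + c n) + - ln (c n) / N n + other_average n (c n)) \<longlonglongrightarrow> b + J 0" by simp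
  then show ?thesis
  proof (rule Lim_transform_eventually)
    show "\<forall>\<^sub>F n in sequentially. ln (1 + c n) + - ln (c n) / N n + other_average n (c n) =
        mass_of_lengths (V n) (p n) (c n) (\<lambda>_. True) / N n"
      using pos eventually_ge_1
    proof eventually_elim
      case (elim n)
      then interpret finite_chain "V n" "p n" "\<pi> n" by (intro fin_chain)
      have "mass_of_lengths (V n) (p n) (c n) (\<lambda>_. True) =
          N n * ln (1 + c n) + (\<Sum>z\<in>#eigenvalues (V n) (p n). log_potential (c n) z)"
        unfolding mass_of_lengths_def length_mass_def log_potential_def sum_mset_neg
        using sums_unique[OF log_det_sums[OF elim(1)]] by simp
      also have "\<dots> = N n * ln (1 + c n) - ln (c n) + (\<Sum>z\<in>#other_eigenvalues (V n) (p n). log_potential (c n) z)"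
        using elim(1) by (simp add: sum_eigenvalues_split log_potential_def)
      finally have eq: "mass_of_lengths (V n) (p n) (c n) (\<lambda>_. True) =
          N n * ln (1 + c n) - ln (c n) + (\<Sum>z\<in>#other_eigenvalues (V n) (p n). log_potential (c n) z)" .
      show ?case
        unfolding eq other_average_def
        using N_pos[OF elim(2)] by (simp add: add_divide_distrib diff_divide_distrib)
    qed
  qed
qed

end

section \<open>Truncation by length\<close>

context finite_chain
begin

lemma mass_of_lengths_antimono:
  assumes "0 < c" "c \<le> c'"
  shows "mass_of_lengths V p c' Q \<le> mass_of_lengths V p c Q"
  unfolding mass_of_lengths_def
proof (intro suminf_le summable_length_mass_if)
  have "inverse ((1 + c') ^ k) \<le> inverse ((1 + c) ^ k)" for k
    using assms by (intro le_imp_inverse_le power_mono) auto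
  then show "(if Q k then length_mass V p c' k else 0) \<le> (if Q k then length_mass V p c k else 0)" for k
    unfolding length_mass_def using return_sum_nonneg by (auto intro!: mult_left_mono divide_right_mono)
qed (use assms in auto)

text \<open>
  Up to the length \<open>u\<close>, killing at the rate \<open>c'\<close> leaves at least the proportion \<open>exp (- c' * u)\<close> of
  the mass.
\<close>

lemma mass_of_short_loops_le:
  assumes c: "0 < c" and c': "0 < c'" and Q: "\<And>k. Q k \<Longrightarrow> real k \<le> u"
  shows "mass_of_lengths V p c Q \<le> exp (c' * u) * mass_of_lengths V p c' (\<lambda>_. True)"
proof -
  have le: "(if Q k then length_mass V p c k else 0) \<le> exp (c' * u) * length_mass V p c' k" for k
  proof (cases "Q k")
    case True
    have "(1 + c') ^ k \<le> exp c' ^ k"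
      using c' by (intro power_mono exp_ge_add_one_self) auto
    also have "\<dots> = exp (c' * k)" by (simp add: exp_of_nat_mult[symmetric] mult.commute)
    also have "\<dots> \<le> exp (c' * u)" using Q[OF True] c' by simp
    finally have "1 \<le> exp (c' * u) * inverse ((1 + c') ^ k)"
      using c' by (simp add: field_simps)
    moreover have "inverse ((1 + c) ^ k) \<le> 1"
      using c by (intro inverse_le_1_iff[THEN iffD2]) (simp add: one_le_power)
    ultimately have "inverse ((1 + c) ^ k) \<le> exp (c' * u) * inverse ((1 + c') ^ k)"
      by linarith
    then have "return_sum V p k / k * inverse ((1 + c) ^ k) \<le>
        return_sum V p k / k * (exp (c' * u) * inverse ((1 + c') ^ k))"
      using return_sum_nonneg by (intro mult_left_mono) auto
    then show ?thesis using True by (simp add: length_mass_def mult_ac)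
  next
    case False
    then show ?thesis using length_mass_nonneg[OF c'] by simp
  qed
  have "mass_of_lengths V p c Q \<le> (\<Sum>k. exp (c' * u) * length_mass V p c' k)"
    unfolding mass_of_lengths_def using le
    by (intro suminf_le summable_length_mass_if summable_mult summable_length_mass c c')
  also have "\<dots> = exp (c' * u) * mass_of_lengths V p c' (\<lambda>_. True)"
    unfolding mass_of_lengths_def using summable_length_mass[OF c'] by (simp add: suminf_mult)
  finally show ?thesis .
qed

text \<open>
  As \<open>1 + 4 * d \<ge> (1 + d)\<^sup>2\<close> for \<open>d \<le> 2\<close>, the killing factor of rate \<open>4 * d\<close> splits into two factors of rate \<open>d\<close>. For
  lengths beyond \<open>u\<close> the first is at most \<open>1 / (1 + d * u)\<close> by Bernoulli's inequality, and the second
  still makes the sum over all lengths finite.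
\<close>

lemma mass_of_long_loops_le:
  assumes d: "0 < d" "d \<le> 2" and u: "0 \<le> u"
  shows "mass_of_lengths V p (4 * d) (\<lambda>k. u \<le> real k) \<le> mass_of_lengths V p d (\<lambda>_. True) / (1 + d * u)"
proof -
  have pos: "0 < 1 + d * u" using d u by (simp add: add_pos_nonneg)
  have le: "(if u \<le> real k then length_mass V p (4 * d) k else 0) \<le> 1 / (1 + d * u) * length_mass V p d k" for k
  proof (cases "u \<le> real k")
    case True
    have "d * u \<le> d * real k" using mult_left_mono[OF True, of d] d by simp
    moreover have "1 + d * real k \<le> (1 + d) ^ k"
      using Bernoulli_inequality[of d k] d by (simp add: mult.commute)
    ultimately have bern: "1 + d * u \<le> (1 + d) ^ k" by linarith
    have "(1 + d) * (1 + d) \<le> 1 + 4 * d"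
      using mult_right_mono[OF d(2), of d] d by (simp add: algebra_simps)
    then have "((1 + d) * (1 + d)) ^ k \<le> (1 + 4 * d) ^ k"
      using d by (intro power_mono) auto
    then have "(1 + d) ^ k * (1 + d) ^ k \<le> (1 + 4 * d) ^ k"
      by (simp add: power_mult_distrib)
    moreover have "(1 + d * u) * (1 + d) ^ k \<le> (1 + d) ^ k * (1 + d) ^ k"
      using bern d by (intro mult_right_mono) auto
    ultimately have "(1 + d * u) * (1 + d) ^ k \<le> (1 + 4 * d) ^ k"
      by linarith
    then have "inverse ((1 + 4 * d) ^ k) \<le> inverse ((1 + d * u) * (1 + d) ^ k)"
      using pos d by (intro le_imp_inverse_le) auto
    then have "return_sum V p k / k * inverse ((1 + 4 * d) ^ k) \<le>
        return_sum V p k / k * inverse ((1 + d * u) * (1 + d) ^ k)"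
      using return_sum_nonneg by (intro mult_left_mono) auto
    then show ?thesis using True by (simp add: length_mass_def divide_inverse mult_ac)
  next
    case False
    then show ?thesis using length_mass_nonneg[OF d(1)] pos by simp
  qed
  have "mass_of_lengths V p (4 * d) (\<lambda>k. u \<le> real k) \<le> (\<Sum>k. 1 / (1 + d * u) * length_mass V p d k)"
    unfolding mass_of_lengths_def using le d
    by (intro suminf_le summable_length_mass_if summable_mult summable_length_mass) auto
  also have "\<dots> = 1 / (1 + d * u) * mass_of_lengths V p d (\<lambda>_. True)"
    unfolding mass_of_lengths_def if_True by (rule suminf_mult[OF summable_length_mass[OF d(1)]])
  finally show ?thesis by simp
qed

end

context chain_sequence
begin

text \<open>
  A Tauberian argument: all masses are nonnegative, so cutting off the lengths at \<open>u\<close> has the same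
  effect as killing at a rate close to \<open>1 / u\<close>, and for such a rate the limit of the total mass is known.
  The rate \<open>e = 1 / (u * ln u)\<close> is so small that loops up to the length \<open>u\<close> hardly feel it, which gives
  the upper bound. The rate \<open>4 * d\<close> with \<open>d = ln u / u\<close> is so large that longer loops lose almost all
  their mass, which gives the lower bound. The extra factors \<open>ln u\<close> change the logarithm of the rate only
  by \<open>ln (ln u)\<close>, which is negligible on the scale of the number of states. The condition \<open>b < a\<close>
  ensures that the killing rate \<open>c\<close> itself is eventually below \<open>4 * d\<close>.
\<close>

lemma truncated_mass_tendsto:
  assumes c: "\<forall>\<^sub>F n in sequentially. 0 < c n" and log_c: "(\<lambda>n. - ln (c n) / N n) \<longlonglongrightarrow> a"
    and u: "filterlim u at_top sequentially" and log_u: "(\<lambda>n. ln (u n) / N n) \<longlonglongrightarrow> b" and ba: "b < a"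
    and Q_lower: "\<And>n k. real k < u n \<Longrightarrow> Q n k" and Q_upper: "\<And>n k. Q n k \<Longrightarrow> real k \<le> u n"
  shows "(\<lambda>n. mass_of_lengths (V n) (p n) (c n) (Q n) / N n) \<longlonglongrightarrow> b + J 0"
proof -
  define L where "L = (\<lambda>n. ln (u n))"
  define d where "d = (\<lambda>n. L n / u n)"
  define e where "e = (\<lambda>n. 1 / (u n * L n))"
  have L: "filterlim L at_top sequentially"
    unfolding L_def by (rule filterlim_compose[OF ln_at_top u])
  have u1: "\<forall>\<^sub>F n in sequentially. 1 < u n" using u by (rule filterlim_at_top_dense[THEN iffD1, rule_format])
  have L0: "\<forall>\<^sub>F n in sequentially. 0 < L n" using L by (rule filterlim_at_top_dense[THEN iffD1, rule_format])
  have dlim: "d \<longlonglongrightarrow> 0"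
    unfolding d_def L_def by (rule filterlim_compose[OF _ u]) real_asymp
  have e_lim: "e \<longlonglongrightarrow> 0"
    unfolding e_def L_def by (rule filterlim_compose[OF _ u]) real_asymp
  have lnL: "(\<lambda>n. ln (L n) / N n) \<longlonglongrightarrow> 0"
  proof -
    have "(\<lambda>n. ln (ln (u n)) / ln (u n)) \<longlonglongrightarrow> 0"
      by (rule filterlim_compose[OF _ u, where g = "\<lambda>x. ln (ln x) / ln x"]) real_asymp
    then have "(\<lambda>n. ln (ln (u n)) / ln (u n) * (ln (u n) / N n)) \<longlonglongrightarrow> 0 * b"
      by (intro tendsto_mult log_u)
    then have "(\<lambda>n. ln (ln (u n)) / ln (u n) * (ln (u n) / N n)) \<longlonglongrightarrow> 0" by simp
    then show ?thesis
    proof (rule Lim_transform_eventually)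
      show "\<forall>\<^sub>F n in sequentially. ln (ln (u n)) / ln (u n) * (ln (u n) / N n) = ln (L n) / N n"
        using L0 by eventually_elim (simp add: L_def)
    qed
  qed
  have logs: "\<forall>\<^sub>F n in sequentially. - ln (e n) / N n = ln (u n) / N n + ln (L n) / N n
      \<and> - ln (d n) / N n = ln (u n) / N n - ln (L n) / N n
      \<and> - ln (4 * d n) / N n = ln (u n) / N n - ln (L n) / N n - ln 4 / N n"
    using u1 L0
  proof eventually_elim
    case (elim n)
    have "ln (e n) = - (ln (u n) + ln (L n))" "ln (d n) = ln (L n) - ln (u n)"
      "ln (4 * d n) = ln 4 + (ln (L n) - ln (u n))"
      using elim by (auto simp: e_def d_def ln_div ln_mult)
    then show ?case by (simp only: add_divide_distrib diff_divide_distrib minus_add_distrib minus_diff_eq) (simp add: diff_divide_distrib add_divide_distrib)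
  qed
  have e_log: "(\<lambda>n. - ln (e n) / N n) \<longlonglongrightarrow> b"
  proof (rule Lim_transform_eventually)
    show "(\<lambda>n. ln (u n) / N n + ln (L n) / N n) \<longlonglongrightarrow> b"
      using tendsto_add[OF log_u lnL] by simp
    show "\<forall>\<^sub>F n in sequentially. ln (u n) / N n + ln (L n) / N n = - ln (e n) / N n"
      using logs by eventually_elim simp
  qed
  have d_log: "(\<lambda>n. - ln (d n) / N n) \<longlonglongrightarrow> b"
  proof (rule Lim_transform_eventually)
    show "(\<lambda>n. ln (u n) / N n - ln (L n) / N n) \<longlonglongrightarrow> b"
      using tendsto_diff[OF log_u lnL] by simp
    show "\<forall>\<^sub>F n in sequentially. ln (u n) / N n - ln (L n) / N n = - ln (d n) / N n"
      using logs by eventually_elim simp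
  qed
  have d4_log: "(\<lambda>n. - ln (4 * d n) / N n) \<longlonglongrightarrow> b"
  proof (rule Lim_transform_eventually)
    show "(\<lambda>n. ln (u n) / N n - ln (L n) / N n - ln 4 / N n) \<longlonglongrightarrow> b"
      using tendsto_diff[OF tendsto_diff[OF log_u lnL] over_N_tendsto_0[of "ln 4"]] by simp
    show "\<forall>\<^sub>F n in sequentially. ln (u n) / N n - ln (L n) / N n - ln 4 / N n = - ln (4 * d n) / N n"
      using logs by eventually_elim simp
  qed
  have d0: "\<forall>\<^sub>F n in sequentially. 0 < d n"
    using u1 L0 by eventually_elim (simp add: d_def)
  have e0: "\<forall>\<^sub>F n in sequentially. 0 < e n"
    using u1 L0 by eventually_elim (simp add: e_def)
  have d2: "\<forall>\<^sub>F n in sequentially. d n < 2"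
    using order_tendstoD(2)[OF dlim, of 2] by simp
  have c_le: "\<forall>\<^sub>F n in sequentially. c n \<le> 4 * d n"
  proof -
    obtain t where t: "b < t" "t < a" using dense[OF ba] by auto
    show ?thesis
      using order_tendstoD(2)[OF d4_log t(1)] order_tendstoD(1)[OF log_c t(2)] c d0 eventually_ge_1
    proof eventually_elim
      case (elim n)
      then have "- ln (4 * d n) / N n < - ln (c n) / N n" by simp
      then have "ln (c n) < ln (4 * d n)"
        using N_pos[OF elim(5)] by (simp add: divide_less_cancel)
      then show ?case using elim by simp
    qed
  qed
  let ?tot = "\<lambda>c n. mass_of_lengths (V n) (p n) (c n) (\<lambda>_. True) / N n"
  have "(\<lambda>n. exp (1 / L n) * ?tot e n) \<longlonglongrightarrow> exp 0 * (b + J 0)"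
    by (intro tendsto_intros total_mass_tendsto e0 e_lim e_log tendsto_divide_0[OF tendsto_const]
        filterlim_at_top_imp_at_infinity L)
  then have upper_lim: "(\<lambda>n. exp (1 / L n) * ?tot e n) \<longlonglongrightarrow> b + J 0" by simp
  have tot_d: "?tot d \<longlonglongrightarrow> b + J 0"
    by (intro total_mass_tendsto d0 dlim d_log)
  have tot_4d: "?tot (\<lambda>n. 4 * d n) \<longlonglongrightarrow> b + J 0"
  proof (rule total_mass_tendsto[OF _ _ d4_log])
    show "\<forall>\<^sub>F n in sequentially. 0 < 4 * d n" using d0 by eventually_elim simp
    show "(\<lambda>n. 4 * d n) \<longlonglongrightarrow> 0" using tendsto_mult[OF tendsto_const dlim, of 4] by simp
  qed
  have "(\<lambda>n. 1 / (1 + L n)) \<longlonglongrightarrow> 0"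
    by (intro tendsto_divide_0[OF tendsto_const] filterlim_at_top_imp_at_infinity
        filterlim_tendsto_add_at_top[OF tendsto_const] L)
  then have "(\<lambda>n. ?tot (\<lambda>n. 4 * d n) n - ?tot d n * (1 / (1 + L n))) \<longlonglongrightarrow> (b + J 0) - (b + J 0) * 0"
    by (intro tendsto_diff tendsto_mult tot_d tot_4d)
  then have lower_lim: "(\<lambda>n. ?tot (\<lambda>n. 4 * d n) n - ?tot d n * (1 / (1 + L n))) \<longlonglongrightarrow> b + J 0" by simp
  have upper: "\<forall>\<^sub>F n in sequentially. mass_of_lengths (V n) (p n) (c n) (Q n) / N n \<le> exp (1 / L n) * ?tot e n"
    using c e0 u1 L0 eventually_ge_1
  proof eventually_elim
    case (elim n)
    then interpret finite_chain "V n" "p n" "\<pi> n" by (intro fin_chain)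
    have "mass_of_lengths (V n) (p n) (c n) (Q n) \<le> exp (e n * u n) * mass_of_lengths (V n) (p n) (e n) (\<lambda>_. True)"
      using elim Q_upper by (intro mass_of_short_loops_le) auto
    moreover have "e n * u n = 1 / L n" using elim by (simp add: e_def)
    ultimately show ?case
      using divide_right_mono[of _ _ "N n"] by (simp add: divide_right_mono)
  qed
  have lower: "\<forall>\<^sub>F n in sequentially. ?tot (\<lambda>n. 4 * d n) n - ?tot d n * (1 / (1 + L n)) \<le>
      mass_of_lengths (V n) (p n) (c n) (Q n) / N n"
    using c c_le d0 d2 u1 L0 eventually_ge_1
  proof eventually_elim
    case (elim n)
    then interpret finite_chain "V n" "p n" "\<pi> n" by (intro fin_chain)
    have du: "d n * u n = L n" using elim by (simp add: d_def)
    have "mass_of_lengths (V n) (p n) (4 * d n) (\<lambda>_. True) =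
        mass_of_lengths (V n) (p n) (4 * d n) (\<lambda>k. real k < u n) +
        mass_of_lengths (V n) (p n) (4 * d n) (\<lambda>k. u n \<le> real k)"
      using mass_of_lengths_split[of "4 * d n" "\<lambda>_. True" "\<lambda>k. real k < u n"] elim by (simp add: not_less)
    moreover have "mass_of_lengths (V n) (p n) (4 * d n) (\<lambda>k. real k < u n) \<le> mass_of_lengths (V n) (p n) (c n) (\<lambda>k. real k < u n)"
      using elim by (intro mass_of_lengths_antimono)
    moreover have "mass_of_lengths (V n) (p n) (c n) (\<lambda>k. real k < u n) \<le> mass_of_lengths (V n) (p n) (c n) (Q n)"
      using elim Q_lower by (intro mass_of_lengths_mono) auto
    moreover have "mass_of_lengths (V n) (p n) (4 * d n) (\<lambda>k. u n \<le> real k) \<le>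
        mass_of_lengths (V n) (p n) (d n) (\<lambda>_. True) / (1 + L n)"
      using mass_of_long_loops_le[of "d n" "u n"] elim unfolding du by simp
    ultimately have "mass_of_lengths (V n) (p n) (4 * d n) (\<lambda>_. True) -
        mass_of_lengths (V n) (p n) (d n) (\<lambda>_. True) / (1 + L n) \<le> mass_of_lengths (V n) (p n) (c n) (Q n)"
      by linarith
    from divide_right_mono[OF this, of "N n"] show ?case
      by (simp add: diff_divide_distrib mult.commute)
  qed
  show ?thesis by (rule tendsto_sandwich[OF lower upper lower_lim upper_lim])
qed

section \<open>Moments and the logarithmic integral of the limit\<close>

lemma spectral_moment:
  assumes "n \<ge> 1"
  shows "(\<Sum>z\<in>#eigenvalues (V n) (p n). Re (z ^ j)) = return_sum (V n) (p n) j"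
    and "(\<Sum>z\<in>#eigenvalues (V n) (p n). Im (z ^ j)) = 0"
proof -
  interpret finite_chain "V n" "p n" "\<pi> n" using assms by (rule fin_chain)
  have Im_sum: "Im (\<Sum>z\<in>#M. f z) = (\<Sum>z\<in>#M. Im (f z))" for M :: "complex multiset" and f
    by (induction M) auto
  have eq: "(\<Sum>z\<in>#eigenvalues (V n) (p n). z ^ j) = complex_of_real (return_sum (V n) (p n) j)"
    using return_sum_eq_power_sum[OF fin] by simp
  show "(\<Sum>z\<in>#eigenvalues (V n) (p n). Re (z ^ j)) = return_sum (V n) (p n) j"
    unfolding Re_sum_mset[symmetric] eq by simp
  show "(\<Sum>z\<in>#eigenvalues (V n) (p n). Im (z ^ j)) = 0"
    unfolding Im_sum[symmetric] eq by simp
qed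

definition moment :: "nat \<Rightarrow> real" where
  "moment j = (\<integral>x. Re (disk_proj x ^ j) \<partial>\<nu>)"

lemma return_sum_tendsto: "(\<lambda>n. return_sum (V n) (p n) j / N n) \<longlonglongrightarrow> moment j"
  unfolding moment_def
proof (rule Lim_transform_eventually[OF spectral_average_tendsto[OF continuous_power_parts(1)]])
  show "\<forall>\<^sub>F n in sequentially. (\<Sum>z\<in>#eigenvalues (V n) (p n). Re (z ^ j)) / N n = return_sum (V n) (p n) j / N n"
    using eventually_ge_1 by eventually_elim (simp only: spectral_moment)
qed

lemma integral_Im_power: "(\<integral>x. Im (disk_proj x ^ j) \<partial>\<nu>) = 0"
proof (rule LIMSEQ_unique[OF spectral_average_tendsto[OF continuous_power_parts(2)]])
  show "(\<lambda>n. (\<Sum>z\<in>#eigenvalues (V n) (p n). Im (z ^ j)) / N n) \<longlonglongrightarrow> 0"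
  proof (rule Lim_transform_eventually[OF tendsto_const])
    show "\<forall>\<^sub>F n in sequentially. 0 = (\<Sum>z\<in>#eigenvalues (V n) (p n). Im (z ^ j)) / N n"
      using eventually_ge_1 by eventually_elim (simp only: spectral_moment div_0)
  qed
qed

lemma set_integral_eq_disk_proj:
  fixes f :: "complex \<Rightarrow> complex"
  assumes "f \<in> borel_measurable borel"
  shows "(LINT x:cball 0 1|\<nu>. f x) = (\<integral>x. f (disk_proj x) \<partial>\<nu>)"
  unfolding set_lebesgue_integral_def
proof (rule integral_cong_AE)
  show "AE x in \<nu>. indicat_real (cball 0 1) x *\<^sub>R f x = f (disk_proj x)"
    using AE_disk by eventually_elim (simp add: disk_proj_self)
  have "(\<lambda>x. indicat_real (cball 0 1) x *\<^sub>R f x) \<in> borel_measurable borel"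
    by (intro borel_measurable_scaleR borel_measurable_indicator assms) auto
  then show "(\<lambda>x. indicat_real (cball 0 1) x *\<^sub>R f x) \<in> borel_measurable \<nu>"
    by (simp add: measurable_cong_sets[OF nu_borel refl])
  show "(\<lambda>x. f (disk_proj x)) \<in> borel_measurable \<nu>"
    using measurable_compose[OF disk_proj_measurable assms] by (simp add: measurable_cong_sets[OF nu_borel refl])
qed

lemma complex_integral_eqI:
  fixes f :: "complex \<Rightarrow> complex"
  assumes "integrable \<nu> f" "(\<integral>x. Re (f x) \<partial>\<nu>) = r" "(\<integral>x. Im (f x) \<partial>\<nu>) = 0"
  shows "(\<integral>x. f x \<partial>\<nu>) = complex_of_real r"
  using assms by (simp add: complex_eq_iff)

lemma set_integral_power: "(LINT x:cball 0 1|\<nu>. x ^ j) = complex_of_real (moment j)"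
proof -
  have "integrable \<nu> (\<lambda>x. disk_proj x ^ j)"
  proof (rule integrable_const_bound[of _ 1])
    show "AE x in \<nu>. norm (disk_proj x ^ j) \<le> 1"
      by (intro AE_I2) (simp add: norm_power power_le_one disk_proj_norm)
  qed measurable
  then show ?thesis
    by (subst set_integral_eq_disk_proj) (auto intro!: complex_integral_eqI integral_Im_power simp: moment_def)
qed

text \<open>
  The imaginary parts of the shifted logarithms cancel exactly over each spectrum. The limit
  distribution inherits this cancellation for every shift, and the shift is then removed by dominated
  convergence.
\<close>

lemma integral_Im_Ln: "(\<integral>x. Im (Ln (1 - disk_proj x)) \<partial>\<nu>) = 0"
proof -
  let ?d = "\<lambda>m :: nat. inverse (real (Suc m))"
  let ?v = "\<lambda>m x. Im (Ln (1 - x / complex_of_real (1 + ?d m)))"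
  have d: "0 < ?d m" for m by simp
  have zero: "(\<integral>x. ?v m (disk_proj x) \<partial>\<nu>) = 0" for m
  proof -
    have "1 + ?d m \<noteq> 0" using d[of m] by linarith
    then have nz: "complex_of_real (1 + ?d m) \<noteq> 0" by (simp only: of_real_eq_0_iff not_False_eq_True)
    have cont: "continuous_on (cball 0 1) (?v m)"
    proof (intro continuous_intros)
      fix x :: complex assume "x \<in> cball 0 1"
      then have x: "cmod x \<le> 1" by simp
      have nd: "cmod (complex_of_real (1 + ?d m)) = 1 + ?d m"
        using d[of m] by (simp only: norm_of_real)
      have "cmod (x / complex_of_real (1 + ?d m)) < 1"
        unfolding norm_divide nd using x d[of m]
        by (intro divide_less_eq_1_pos[THEN iffD2]) linarith+
      then show "1 - x / complex_of_real (1 + ?d m) \<notin> \<real>\<^sub>\<le>\<^sub>0"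
        by (intro one_minus_not_nonpos_Reals) auto
    qed (use nz in blast)
    show ?thesis
    proof (rule LIMSEQ_unique[OF spectral_average_tendsto[OF cont]])
      show "(\<lambda>n. (\<Sum>z\<in>#eigenvalues (V n) (p n). ?v m z) / N n) \<longlonglongrightarrow> 0"
      proof (rule Lim_transform_eventually[OF tendsto_const])
        show "\<forall>\<^sub>F n in sequentially. 0 = (\<Sum>z\<in>#eigenvalues (V n) (p n). ?v m z) / N n"
          using eventually_ge_1
          by eventually_elim (simp only: finite_chain.sum_Im_Ln_eq_0[OF fin_chain d] div_0)
      qed
    qed
  qed
  have "(\<lambda>m. \<integral>x. ?v m (disk_proj x) \<partial>\<nu>) \<longlonglongrightarrow> (\<integral>x. Im (Ln (1 - disk_proj x)) \<partial>\<nu>)"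
  proof (rule integral_dominated_convergence)
    show "integrable \<nu> (\<lambda>_. pi)" by simp
    show "AE x in \<nu>. (\<lambda>m. ?v m (disk_proj x)) \<longlonglongrightarrow> Im (Ln (1 - disk_proj x))"
      using AE_disk_proj_ne_1
    proof eventually_elim
      case (elim x)
      have "(\<lambda>m. 1 - disk_proj x / complex_of_real (1 + ?d m)) \<longlonglongrightarrow> 1 - disk_proj x / complex_of_real (1 + 0)"
        by (intro tendsto_intros LIMSEQ_inverse_real_of_nat) auto
      then have "(\<lambda>m. 1 - disk_proj x / complex_of_real (1 + ?d m)) \<longlonglongrightarrow> 1 - disk_proj x" by simp
      then show ?case
        using one_minus_not_nonpos_Reals[OF disk_proj_norm elim] by (intro tendsto_Im tendsto_Ln) auto
    qed
    show "AE x in \<nu>. norm (?v m (disk_proj x)) \<le> pi" for m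
    proof (intro AE_I2)
      fix x
      have nd: "cmod (complex_of_real (1 + ?d m)) = 1 + ?d m"
        using d[of m] by (simp only: norm_of_real)
      have "cmod (disk_proj x / complex_of_real (1 + ?d m)) < 1"
        unfolding norm_divide nd using disk_proj_norm[of x] d[of m]
        by (intro divide_less_eq_1_pos[THEN iffD2]) linarith+
      then have "1 - disk_proj x / complex_of_real (1 + ?d m) \<noteq> 0" by auto
      then show "norm (?v m (disk_proj x)) \<le> pi"
        using mpi_less_Im_Ln Im_Ln_le_pi by (simp add: abs_le_iff less_imp_le minus_le_iff)
    qed
  qed measurable
  then show ?thesis unfolding zero LIMSEQ_const_iff by (rule sym)
qed

lemma neg_log_integral_eq: "neg_log_integral \<nu> = complex_of_real (J 0)"
proof -
  have ne: "AE x in \<nu>. cmod (- Ln (1 - disk_proj x)) \<le> 3 + log_potential 0 (disk_proj x)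
      \<and> Re (- Ln (1 - disk_proj x)) = log_potential 0 (disk_proj x)"
    using AE_disk_proj_ne_1
  proof eventually_elim
    case (elim x)
    then show ?case using norm_Ln_le[OF disk_proj_norm elim] by (auto simp: log_potential_def)
  qed
  have int: "integrable \<nu> (\<lambda>x. - Ln (1 - disk_proj x))"
  proof (rule Bochner_Integration.integrable_bound)
    show "integrable \<nu> (\<lambda>x. 3 + log_potential 0 (disk_proj x))"
      using integrable_log_potential_0 by simp
    show "AE x in \<nu>. norm (- Ln (1 - disk_proj x)) \<le> norm (3 + log_potential 0 (disk_proj x))"
      using ne by eventually_elim (simp only: real_norm_def, linarith)
  qed measurable
  have "(\<integral>x. Re (- Ln (1 - disk_proj x)) \<partial>\<nu>) = J 0"
    unfolding J_def
  proof (rule integral_cong_AE)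
    show "AE x in \<nu>. Re (- Ln (1 - disk_proj x)) = log_potential 0 (disk_proj x)"
      using ne by eventually_elim simp
  qed measurable
  moreover have "(\<integral>x. Im (- Ln (1 - disk_proj x)) \<partial>\<nu>) = 0"
    using integral_Im_Ln by simp
  ultimately have "(\<integral>x. - Ln (1 - disk_proj x) \<partial>\<nu>) = complex_of_real (J 0)"
    by (intro complex_integral_eqI int)
  then show ?thesis
    unfolding neg_log_integral_def by (subst set_integral_eq_disk_proj) auto
qed

end

section \<open>Limits for short and long loops\<close>

lemma cdf_uniform_interval:
  fixes a x :: real
  assumes "a > 0"
  shows "cdf (uniform_measure lborel {0<..<a}) x = (if x \<le> 0 then 0 else if x < a then x / a else 1)"
proof -
  have "cdf (uniform_measure lborel {0<..<a}) x = measure lborel ({0<..<a} \<inter> {..x}) / measure lborel {0<..<a}"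
    unfolding cdf_def using assms by (intro measure_uniform_measure) auto
  also have "{0<..<a} \<inter> {..x} = (if x \<le> 0 then {} else if x < a then {0<..x} else {0<..<a})"
    by auto
  finally show ?thesis using assms by simp
qed

text \<open>
  From here on the killing rates decay like \<open>exp (- a * N)\<close>, and \<open>q\<close> separates the short loops from the
  long ones.
\<close>

locale loop_sequence = chain_sequence +
  fixes a :: real and c q :: "nat \<Rightarrow> real"
  assumes a_pos: "a > 0"
    and kill_pos: "n \<ge> 1 \<Longrightarrow> 0 < c n"
    and kill_log: "(\<lambda>n. - ln (c n) / N n) \<longlonglongrightarrow> a"
    and q_lim: "filterlim q at_top sequentially"
    and q_log: "(\<lambda>n. ln (q n) / N n) \<longlonglongrightarrow> 0"
begin

abbreviation "mass n Q \<equiv> mass_of_lengths (V n) (p n) (c n) Q"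

lemma kill_pos_ev: "\<forall>\<^sub>F n in sequentially. 0 < c n"
  using eventually_ge_1 by eventually_elim (rule kill_pos)

lemma kill_lim: "c \<longlonglongrightarrow> 0"
proof -
  have "filterlim (\<lambda>n. - ln (c n) / N n * N n) at_top sequentially"
    by (rule filterlim_tendsto_pos_mult_at_top[OF kill_log a_pos card_lim])
  then have "(\<lambda>n. exp (- (- ln (c n) / N n * N n))) \<longlonglongrightarrow> 0"
    by (intro filterlim_compose[OF exp_at_bot] filterlim_uminus_at_bot_at_top[THEN filterlim_compose])
  then show ?thesis
  proof (rule Lim_transform_eventually)
    show "\<forall>\<^sub>F n in sequentially. exp (- (- ln (c n) / N n * N n)) = c n"
      using eventually_ge_1 by eventually_elim (use N_pos kill_pos in simp)
  qed
qed

lemma total_lim: "(\<lambda>n. mass n (\<lambda>_. True) / N n) \<longlonglongrightarrow> a + J 0"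
  by (intro total_mass_tendsto kill_pos_ev kill_lim kill_log)

lemmas short_lim = truncated_mass_tendsto[OF kill_pos_ev kill_log]

lemma upto_q_lim: "(\<lambda>n. mass n (\<lambda>k. real k \<le> q n) / N n) \<longlonglongrightarrow> J 0"
  using short_lim[OF q_lim q_log a_pos, of "\<lambda>n k. real k \<le> q n"] by simp

lemma below_q_lim: "(\<lambda>n. mass n (\<lambda>k. real k < q n) / N n) \<longlonglongrightarrow> J 0"
  using short_lim[OF q_lim q_log a_pos, of "\<lambda>n k. real k < q n"] by simp

lemma length_mass_lim: "(\<lambda>n. length_mass (V n) (p n) (c n) j / N n) \<longlonglongrightarrow> moment j / j"
proof -
  have "(\<lambda>n. return_sum (V n) (p n) j / N n / j * inverse ((1 + c n) ^ j)) \<longlonglongrightarrow> moment j / j * inverse ((1 + 0) ^ j)"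
    unfolding divide_inverse[of _ "real j"]
    by (intro tendsto_intros return_sum_tendsto kill_lim) auto
  then show ?thesis by (simp add: length_mass_def mult_ac)
qed

text \<open>
  Loops of length two alone already have a positive mass per state.
\<close>

lemma J_0_pos: "J 0 > 0"
proof -
  have "c\<^sub>2 \<le> moment 2"
  proof (rule tendsto_lowerbound[OF return_sum_tendsto])
    show "\<forall>\<^sub>F n in sequentially. c\<^sub>2 \<le> return_sum (V n) (p n) 2 / N n"
      using eventually_ge_1
    proof eventually_elim
      case (elim n)
      then interpret elliptic_chain "V n" "p n" "\<pi> n" c\<^sub>1 c\<^sub>2 by (rule chain)
      show ?case using return_sum_two_ge N_pos[OF elim] by (simp add: field_simps)
    qed
  qed simp
  moreover have "moment 2 / real 2 \<le> J 0"
  proof (rule tendsto_le[OF _ upto_q_lim length_mass_lim])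
    show "\<forall>\<^sub>F n in sequentially. length_mass (V n) (p n) (c n) 2 / N n \<le> mass n (\<lambda>k. real k \<le> q n) / N n"
      using eventually_ge_1 filterlim_at_top[THEN iffD1, OF q_lim, rule_format, of 2]
    proof eventually_elim
      case (elim n)
      then interpret finite_chain "V n" "p n" "\<pi> n" by (intro fin_chain)
      have "mass n (\<lambda>k. k = 2) \<le> mass n (\<lambda>k. real k \<le> q n)"
        using elim by (intro mass_of_lengths_mono kill_pos) auto
      then show ?case by (intro divide_right_mono) auto
    qed
  qed simp
  ultimately show ?thesis using c_pos(2) by simp
qed

text \<open>
  The cut-off \<open>q\<close> is subexponential, so the short loops take up exactly the part \<open>J 0\<close> of the total mass
  per state and leave the contribution \<open>a\<close> of the eigenvalue \<open>1\<close> to the long ones.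
\<close>

lemma from_q_lim: "(\<lambda>n. mass n (\<lambda>k. q n \<le> real k) / N n) \<longlonglongrightarrow> a"
proof -
  have "(\<lambda>n. mass n (\<lambda>_. True) / N n - mass n (\<lambda>k. real k < q n) / N n) \<longlonglongrightarrow> (a + J 0) - J 0"
    by (intro tendsto_diff total_lim below_q_lim)
  then have "(\<lambda>n. mass n (\<lambda>_. True) / N n - mass n (\<lambda>k. real k < q n) / N n) \<longlonglongrightarrow> a" by simp
  then show ?thesis
  proof (rule Lim_transform_eventually)
    show "\<forall>\<^sub>F n in sequentially. mass n (\<lambda>_. True) / N n - mass n (\<lambda>k. real k < q n) / N n =
        mass n (\<lambda>k. q n \<le> real k) / N n"
      using eventually_ge_1
    proof eventually_elim
      case (elim n)
      then interpret finite_chain "V n" "p n" "\<pi> n" by (rule fin_chain)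
      show ?case
        using mass_of_lengths_split[OF kill_pos[OF elim], of "\<lambda>_. True" "\<lambda>k. real k < q n"]
        by (simp add: not_less diff_divide_distrib[symmetric])
    qed
  qed
qed

lemma ratio_tendsto:
  assumes f: "(\<lambda>n. f n / N n) \<longlonglongrightarrow> r" and g: "(\<lambda>n. g n / N n) \<longlonglongrightarrow> s" and s: "s \<noteq> 0"
  shows "(\<lambda>n. f n / g n) \<longlonglongrightarrow> r / s"
proof (rule Lim_transform_eventually[OF tendsto_divide[OF f g s]])
  show "\<forall>\<^sub>F n in sequentially. f n / N n / (g n / N n) = f n / g n"
    using eventually_ge_1 by eventually_elim (use N_pos in simp)
qed

lemma long_loop_probability:
  "(\<lambda>n. \<P>(L in normalized_loop_measure (V n) (p n) (c n). real (loop_length L) \<ge> q n)) \<longlonglongrightarrow> a / (a + J 0)"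
proof (rule Lim_transform_eventually[OF ratio_tendsto[OF from_q_lim total_lim]])
  show "a + J 0 \<noteq> 0" using a_pos J_0_pos by simp
  show "\<forall>\<^sub>F n in sequentially. mass n (\<lambda>k. q n \<le> real k) / mass n (\<lambda>_. True) =
      \<P>(L in normalized_loop_measure (V n) (p n) (c n). real (loop_length L) \<ge> q n)"
    using eventually_ge_1
    by eventually_elim (rule finite_chain.measure_normalized_loop_measure[OF fin_chain kill_pos, symmetric])
qed

lemma short_loop_length_law:
  "(\<lambda>n. \<P>(L in normalized_loop_measure (V n) (p n) (c n). loop_length L = j \<bar> real (loop_length L) \<le> q n))
    \<longlonglongrightarrow> moment j / j / J 0"
proof (rule Lim_transform_eventually[OF ratio_tendsto[OF length_mass_lim upto_q_lim]])
  show "J 0 \<noteq> 0" using J_0_pos by simp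
  show "\<forall>\<^sub>F n in sequentially. length_mass (V n) (p n) (c n) j / mass n (\<lambda>k. real k \<le> q n) =
      \<P>(L in normalized_loop_measure (V n) (p n) (c n). loop_length L = j \<bar> real (loop_length L) \<le> q n)"
    using eventually_ge_1 filterlim_at_top[THEN iffD1, OF q_lim, rule_format, of "real j"]
  proof eventually_elim
    case (elim n)
    then interpret finite_chain "V n" "p n" "\<pi> n" by (intro fin_chain)
    have "(\<lambda>k. k = j \<and> real k \<le> q n) = (\<lambda>k. k = j)" using elim by auto
    then show ?case
      using cond_prob_normalized_loop_measure[OF kill_pos[OF elim(1)], of "\<lambda>k. k = j" "\<lambda>k. real k \<le> q n"] by simp
  qed
qed

definition log_length_cdf :: "nat \<Rightarrow> real \<Rightarrow> real" where
  "log_length_cdf n x = mass n (\<lambda>k. q n \<le> real k \<and> ln (real k) / N n \<le> x) / mass n (\<lambda>k. q n \<le> real k)"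

lemma from_q_pos: "\<forall>\<^sub>F n in sequentially. 0 < mass n (\<lambda>k. q n \<le> real k)"
  using order_tendstoD(1)[OF from_q_lim a_pos] eventually_ge_1
  by eventually_elim (simp add: zero_less_divide_iff)

text \<open>
  The condition on the logarithm cuts the lengths off at \<open>exp (x * N)\<close>. Per state, the loops up to this
  length have the mass \<open>x + J 0\<close> and the short ones \<open>J 0\<close>, so the mass in between is proportional to \<open>x\<close>.
\<close>

lemma log_length_cdf_interior:
  assumes x: "0 < x" "x < a"
  shows "(\<lambda>n. log_length_cdf n x) \<longlonglongrightarrow> x / a"
  unfolding log_length_cdf_def
proof (rule ratio_tendsto[OF _ from_q_lim])
  have u: "filterlim (\<lambda>n. exp (x * N n)) at_top sequentially"
    by (intro filterlim_compose[OF exp_at_top] filterlim_tendsto_pos_mult_at_top[OF tendsto_const x(1) card_lim])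
  have "(\<lambda>n. ln (exp (x * N n)) / N n) \<longlonglongrightarrow> x"
  proof (rule Lim_transform_eventually[OF tendsto_const])
    show "\<forall>\<^sub>F n in sequentially. x = ln (exp (x * N n)) / N n"
      using eventually_ge_1 by eventually_elim (use N_pos in simp)
  qed
  from short_lim[OF u this x(2), of "\<lambda>n k. real k \<le> exp (x * N n)"]
  have "(\<lambda>n. mass n (\<lambda>k. real k \<le> exp (x * N n)) / N n) \<longlonglongrightarrow> x + J 0" by simp
  from tendsto_diff[OF this below_q_lim]
  have "(\<lambda>n. mass n (\<lambda>k. real k \<le> exp (x * N n)) / N n - mass n (\<lambda>k. real k < q n) / N n) \<longlonglongrightarrow> x" by simp
  then show "(\<lambda>n. mass n (\<lambda>k. q n \<le> real k \<and> ln (real k) / N n \<le> x) / N n) \<longlonglongrightarrow> x"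
  proof (rule Lim_transform_eventually)
    show "\<forall>\<^sub>F n in sequentially. mass n (\<lambda>k. real k \<le> exp (x * N n)) / N n - mass n (\<lambda>k. real k < q n) / N n =
        mass n (\<lambda>k. q n \<le> real k \<and> ln (real k) / N n \<le> x) / N n"
      using eventually_ge_1 filterlim_at_top[THEN iffD1, OF q_lim, rule_format, of 1] order_tendstoD(2)[OF q_log x(1)]
    proof eventually_elim
      case (elim n)
      then interpret finite_chain "V n" "p n" "\<pi> n" by (intro fin_chain)
      have "ln (q n) < x * N n" using elim N_pos[OF elim(1)] by (simp add: field_simps)
      then have "exp (ln (q n)) < exp (x * N n)" by (simp only: exp_less_cancel_iff)
      then have q_le: "q n < exp (x * N n)" using elim(2) by simp
      have iff: "ln (real k) / N n \<le> x \<longleftrightarrow> real k \<le> exp (x * N n)" if "q n \<le> real k" for k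
      proof -
        have "0 < real k" using that elim(2) by linarith
        then have "real k \<le> exp (x * N n) \<longleftrightarrow> ln (real k) \<le> x * N n"
          using exp_le_cancel_iff[of "ln (real k)" "x * N n"] by (simp only: exp_ln)
        then show ?thesis using N_pos[OF elim(1)] by (simp add: field_simps)
      qed
      have "mass n (\<lambda>k. real k \<le> exp (x * N n)) =
          mass n (\<lambda>k. real k \<le> exp (x * N n) \<and> real k < q n) +
          mass n (\<lambda>k. real k \<le> exp (x * N n) \<and> \<not> real k < q n)"
        by (rule mass_of_lengths_split[OF kill_pos[OF elim(1)]])
      moreover have "(\<lambda>k. real k \<le> exp (x * N n) \<and> real k < q n) = (\<lambda>k. real k < q n)"
        using q_le by auto
      moreover have "(\<lambda>k. real k \<le> exp (x * N n) \<and> \<not> real k < q n) =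
          (\<lambda>k. q n \<le> real k \<and> ln (real k) / N n \<le> x)"
        using iff by (auto simp: fun_eq_iff not_less)
      ultimately show ?case by (simp add: diff_divide_distrib[symmetric])
    qed
  qed
qed (use a_pos in simp)

lemma log_length_cdf_mono:
  assumes "n \<ge> 1" "x \<le> y"
  shows "log_length_cdf n x \<le> log_length_cdf n y"
proof -
  interpret finite_chain "V n" "p n" "\<pi> n" using assms by (intro fin_chain)
  show ?thesis
    unfolding log_length_cdf_def using assms(2)
    by (intro divide_right_mono mass_of_lengths_mono mass_of_lengths_nonneg kill_pos assms(1)) auto
qed

text \<open>
  Below the interval the event is empty once \<open>q \<ge> 2\<close>; above it, monotonicity compares with interior
  points that approach \<open>a\<close>.
\<close>

lemma log_length_cdf_tendsto:
  "(\<lambda>n. log_length_cdf n x) \<longlonglongrightarrow> (if x \<le> 0 then 0 else if x < a then x / a else 1)"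
proof -
  consider "x \<le> 0" | "0 < x" "x < a" | "a \<le> x" by linarith
  then show ?thesis
  proof cases
    case 1
    have "(\<lambda>n. log_length_cdf n x) \<longlonglongrightarrow> 0"
    proof (rule Lim_transform_eventually[OF tendsto_const])
      show "\<forall>\<^sub>F n in sequentially. 0 = log_length_cdf n x"
        using eventually_ge_1 filterlim_at_top[THEN iffD1, OF q_lim, rule_format, of 2]
      proof eventually_elim
        case (elim n)
        have "\<not> (q n \<le> real k \<and> ln (real k) / N n \<le> x)" for k
        proof
          assume k: "q n \<le> real k \<and> ln (real k) / N n \<le> x"
          then have "0 < ln (real k)" using elim(2) by (intro ln_gt_zero) linarith
          then have "0 < ln (real k) / N n" using N_pos[OF elim(1)] by simp
          then show False using k 1 by linarith
        qed
        then have "(\<lambda>k. q n \<le> real k \<and> ln (real k) / N n \<le> x) = (\<lambda>_. False)"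
          by blast
        then show ?case by (simp add: log_length_cdf_def mass_of_lengths_def)
      qed
    qed
    then show ?thesis using 1 by simp
  next
    case 2
    then show ?thesis using log_length_cdf_interior by simp
  next
    case 3
    have le: "\<forall>\<^sub>F n in sequentially. log_length_cdf n x \<le> 1"
      using eventually_ge_1 from_q_pos
    proof eventually_elim
      case (elim n)
      then interpret finite_chain "V n" "p n" "\<pi> n" by (intro fin_chain)
      have "mass n (\<lambda>k. q n \<le> real k \<and> ln (real k) / N n \<le> x) \<le> mass n (\<lambda>k. q n \<le> real k)"
        by (intro mass_of_lengths_mono kill_pos elim(1)) auto
      then show ?case using elim(2) by (simp add: log_length_cdf_def)
    qed
    have "(\<lambda>n. log_length_cdf n x) \<longlonglongrightarrow> 1"
    proof (rule order_tendstoI)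
      fix l :: real assume "l < 1"
      define m where "m = (max l 0 + 1) / 2"
      have m: "0 < m" "m < 1" "l < m" using \<open>l < 1\<close> by (auto simp: m_def)
      define y where "y = m * a"
      have y: "0 < y" "y < a" "l < y / a"
        using m a_pos by (simp_all add: y_def)
      show "\<forall>\<^sub>F n in sequentially. l < log_length_cdf n x"
        using order_tendstoD(1)[OF log_length_cdf_interior[OF y(1,2)] y(3)] eventually_ge_1
      proof eventually_elim
        case (elim n)
        then show ?case using log_length_cdf_mono[of n y x] y 3 by simp
      qed
    next
      fix u :: real assume "1 < u"
      then show "\<forall>\<^sub>F n in sequentially. log_length_cdf n x < u"
        using le by (auto elim: eventually_mono)
    qed
    then show ?thesis using 3 a_pos by simp
  qed
qed

lemma log_length_weak_convergence:
  "weak_conv_m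
     (\<lambda>n. let M = normalized_loop_measure (V n) (p n) (c n) in
        distr (uniform_measure M {L \<in> space M. real (loop_length L) \<ge> q n}) borel
          (\<lambda>L. ln (real (loop_length L)) / real (card (V n))))
     (uniform_measure lborel {0<..<a})"
  unfolding weak_conv_m_def weak_conv_def Let_def
proof (intro allI impI)
  fix x
  show "(\<lambda>n. cdf (distr (uniform_measure (normalized_loop_measure (V n) (p n) (c n))
        {L \<in> space (normalized_loop_measure (V n) (p n) (c n)). real (loop_length L) \<ge> q n}) borel
        (\<lambda>L. ln (real (loop_length L)) / real (card (V n)))) x)
      \<longlonglongrightarrow> cdf (uniform_measure lborel {0<..<a}) x"
    unfolding cdf_uniform_interval[OF a_pos]
  proof (rule Lim_transform_eventually[OF log_length_cdf_tendsto])
    show "\<forall>\<^sub>F n in sequentially. log_length_cdf n x =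
        cdf (distr (uniform_measure (normalized_loop_measure (V n) (p n) (c n))
          {L \<in> space (normalized_loop_measure (V n) (p n) (c n)). real (loop_length L) \<ge> q n}) borel
          (\<lambda>L. ln (real (loop_length L)) / real (card (V n)))) x"
      using eventually_ge_1 from_q_pos
    proof eventually_elim
      case (elim n)
      show ?case
        unfolding log_length_cdf_def
        by (rule finite_chain.cdf_conditional_length[OF fin_chain kill_pos, OF elim(1) elim(1) elim(2),
            of "\<lambda>k. ln (real k) / real (card (V n))" x, symmetric])
    qed
  qed
qed

end

theorem theorem1p1:
  fixes a c\<^sub>1 c\<^sub>2 :: real
    and V :: "nat \<Rightarrow> 'a set"
    and p :: "nat \<Rightarrow> 'a \<Rightarrow> 'a \<Rightarrow> real"
    and \<pi> :: "nat \<Rightarrow> 'a \<Rightarrow> real"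
    and c q :: "nat \<Rightarrow> real"
    and \<nu> :: "complex measure"
  assumes a_pos: "a > 0"
    and states: "\<And>n. n \<ge> 1 \<Longrightarrow> finite (V n) \<and> V n \<noteq> {}"
    and transition: "\<And>n. n \<ge> 1 \<Longrightarrow> transition_matrix (V n) (p n)"
    and irred: "\<And>n. n \<ge> 1 \<Longrightarrow> irreducible_chain (V n) (p n)"
    and stationary: "\<And>n. n \<ge> 1 \<Longrightarrow> stationary_distribution (V n) (p n) (\<pi> n)"
    and c_pos: "\<And>n. n \<ge> 1 \<Longrightarrow> c n > 0"
    and c_asymp: "\<exists>r. r \<in> o(\<lambda>n. real (card (V n))) \<and>
                   (\<forall>n\<ge>1. c n = exp (- a * real (card (V n)) + r n))"
    and nu_prob: "prob_space \<nu>"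
    and nu_borel: "sets \<nu> = sets borel"
    and nu_lim: "weakly_converges (\<lambda>n. eigenvalue_distribution (V n) (p n)) \<nu>"
    and c1_pos: "c\<^sub>1 > 0"
    and c2_pos: "c\<^sub>2 > 0"
    and pi_bound: "\<And>n. n \<ge> 1 \<Longrightarrow> Min (\<pi> n ` V n) * real (card (V n)) \<ge> c\<^sub>1"
    and p_bound: "\<And>n. n \<ge> 1 \<Longrightarrow>
                   Min {p n x y | x y. x \<in> V n \<and> y \<in> V n \<and> p n x y + p n y x > 0} \<ge> c\<^sub>2"
    and q_lim: "filterlim q at_top sequentially"
    and q_growth: "(\<lambda>n. ln (q n)) \<in> o(\<lambda>n. real (card (V n)))"
  shows
    "(\<integral>\<^sup>+ x\<in>cball 0 1. abs_log_one_minus x \<partial>\<nu>)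
        \<le> ennreal (3 + 8 * sqrt 2 * inverse c\<^sub>1 * inverse (c\<^sub>2 ^ 4))
     \<and> (\<lambda>n. complex_of_real (total_mass (loop_measure (V n) (p n) (c n)) / real (card (V n))))
        \<longlonglongrightarrow> complex_of_real a + neg_log_integral \<nu>
     \<and> (\<lambda>n. complex_of_real
              (\<P>(L in normalized_loop_measure (V n) (p n) (c n). real (loop_length L) \<ge> q n)))
        \<longlonglongrightarrow> complex_of_real a / (complex_of_real a + neg_log_integral \<nu>)
     \<and> (\<forall>j\<ge>1. (\<lambda>n. complex_of_real
              (\<P>(L in normalized_loop_measure (V n) (p n) (c n).
                  loop_length L = j \<bar> real (loop_length L) \<le> q n)))
        \<longlonglongrightarrow> (1 / of_nat j) * (LINT x:cball 0 1|\<nu>. x ^ j) / neg_log_integral \<nu>)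
     \<and> weak_conv_m
         (\<lambda>n. let M = normalized_loop_measure (V n) (p n) (c n) in
            distr (uniform_measure M {L \<in> space M. real (loop_length L) \<ge> q n}) borel
              (\<lambda>L. ln (real (loop_length L)) / real (card (V n))))
         (uniform_measure lborel {0<..<a})"
proof -
  have card_lim: "filterlim (\<lambda>n. real (card (V n))) at_top sequentially"
  proof (rule filterlim_at_top_mono)
    show "filterlim (\<lambda>n. ln (q n)) at_top sequentially"
      by (rule filterlim_compose[OF ln_at_top q_lim])
    show "\<forall>\<^sub>F n in sequentially. ln (q n) \<le> real (card (V n))"
      using landau_o.smallD[OF q_growth, of 1] by (auto elim: eventually_mono)
  qed
  have q_log: "(\<lambda>n. ln (q n) / real (card (V n))) \<longlonglongrightarrow> 0"
    using q_growth by (rule smalloD_tendsto)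
  obtain r where r: "r \<in> o(\<lambda>n. real (card (V n)))"
    "\<And>n. n \<ge> 1 \<Longrightarrow> c n = exp (- a * real (card (V n)) + r n)"
    using c_asymp by auto
  have kill_log: "(\<lambda>n. - ln (c n) / real (card (V n))) \<longlonglongrightarrow> a"
  proof (rule Lim_transform_eventually)
    show "(\<lambda>n. a - r n / real (card (V n))) \<longlonglongrightarrow> a"
      using tendsto_diff[OF tendsto_const smalloD_tendsto[OF r(1)], of a] by simp
    show "\<forall>\<^sub>F n in sequentially. a - r n / real (card (V n)) = - ln (c n) / real (card (V n))"
      using eventually_ge_at_top[of 1]
    proof eventually_elim
      case (elim n)
      then have "card (V n) > 0" using states by (simp add: card_gt_0_iff)
      then show ?case using r(2)[OF elim] by (simp add: field_simps)
    qed
  qed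
  have chain: "elliptic_chain (V n) (p n) (\<pi> n) c\<^sub>1 c\<^sub>2" if n: "n \<ge> 1" for n
  proof
    show "finite (V n)" "V n \<noteq> {}" using states[OF n] by auto
    show "c\<^sub>1 \<le> \<pi> n x * card (V n)" if "x \<in> V n" for x
    proof -
      have "Min (\<pi> n ` V n) * real (card (V n)) \<le> \<pi> n x * real (card (V n))"
        using states[OF n] that by (intro mult_right_mono Min_le) auto
      then show ?thesis using pi_bound[OF n] by linarith
    qed
    show "c\<^sub>2 \<le> p n x y" if "x \<in> V n" "y \<in> V n" "0 < p n x y + p n y x" for x y
    proof -
      let ?S = "{p n x y | x y. x \<in> V n \<and> y \<in> V n \<and> p n x y + p n y x > 0}"
      have "?S \<subseteq> (\<lambda>(x, y). p n x y) ` (V n \<times> V n)" by auto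
      then have "finite ?S" by (rule finite_subset) (use states[OF n] in auto)
      then have "Min ?S \<le> p n x y" using that by (intro Min_le) auto
      then show ?thesis using p_bound[OF n] by linarith
    qed
  qed (use transition[OF n] irred[OF n] stationary[OF n] c1_pos c2_pos in auto)
  interpret loop_sequence V p \<pi> c\<^sub>1 c\<^sub>2 \<nu> a c q
    by (intro loop_sequence.intro chain_sequence.intro loop_sequence_axioms.intro chain c_pos)
      (assumption | fact nu_prob nu_borel nu_lim card_lim a_pos kill_log q_lim q_log)+
  have total: "(\<lambda>n. total_mass (loop_measure (V n) (p n) (c n)) / real (card (V n))) \<longlonglongrightarrow> a + J 0"
  proof (rule Lim_transform_eventually[OF total_lim])
    show "\<forall>\<^sub>F n in sequentially. mass_of_lengths (V n) (p n) (c n) (\<lambda>_. True) / real (card (V n)) =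
        total_mass (loop_measure (V n) (p n) (c n)) / real (card (V n))"
      using eventually_ge_1
      by eventually_elim (simp add: finite_chain.total_mass_loop_measure[OF fin_chain kill_pos])
  qed
  have limit_b: "complex_of_real a + neg_log_integral \<nu> = complex_of_real (a + J 0)"
    by (simp add: neg_log_integral_eq)
  have limit_c: "complex_of_real a / complex_of_real (a + J 0) = complex_of_real (a / (a + J 0))"
    by simp
  have limit_d: "(1 / of_nat j) * (LINT x:cball 0 1|\<nu>. x ^ j) / neg_log_integral \<nu> =
      complex_of_real (moment j / j / J 0)" for j
    by (simp add: neg_log_integral_eq set_integral_power)
  show ?thesis
    unfolding limit_b limit_c limit_d
    by (intro conjI allI impI nn_integral_abs_log tendsto_of_real total long_loop_probability
        short_loop_length_law log_length_weak_convergence)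
qed

end
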